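(* Let $\delta$ be a zero-mean homogeneous isotropic Gaussian random field on $\mathbb{R}^3$ (smoothed on some scale) with variance $\sigma_\delta^2>0$, let $\Psi$ be its tidal tensor at a point, and let $\lambda_1\ge\lambda_2\ge\lambda_3$ be the ordered eigenvalues of $\Psi$. With classification threshold $0$, let $F_{\rm C}^{(V)},F_{\rm F}^{(V)},F_{\rm W}^{(V)},F_{\rm V}^{(V)}$ be the probabilities that exactly $3$, $2$, $1$, $0$ of the eigenvalues, respectively, are positive. Then $$F_{\rm C}^{(V)}=F_{\rm V}^{(V)}\qquad\text{and}\qquad F_{\rm F}^{(V)}=F_{\rm W}^{(V)}$$ exactly.
   Context: The tidal tensor is $\Psi_{ij}=\partial_i\partial_j\phi$, where the potential $\phi$ is normalized so that $\nabla^2\phi=\delta$, i.e. $\operatorname{Tr}\Psi=\delta$. At a given point $\Psi$ is a random real symmetric $3\times3$ matrix whose entries are jointly Gaussian with mean zero and, by isotropy, covariance $$\langle\Psi_{ij}\Psi_{kl}\rangle=\frac{\sigma_\delta^2}{15}\left(\delta_{ij}\delta_{kl}+\delta_{ik}\delta_{jl}+\delta_{il}\delta_{jk}\right)$$ (Kronecker deltas on the right). Equivalently, the ordered eigenvalues have joint density on $\{\lambda_1\ge\lambda_2\ge\lambda_3\}$ (Doroshkevich density) $$\frac{15^3}{8\pi\sqrt5\,\sigma_\delta^6}(\lambda_1-\lambda_2)(\lambda_1-\lambda_3)(\lambda_2-\lambda_3)\exp\left[-\frac{6I_1^2-15I_2}{2\sigma_\delta^2}\right],$$ with $I_1=\lambda_1+\lambda_2+\lambda_3$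 and $I_2=\lambda_1\lambda_2+\lambda_1\lambda_3+\lambda_2\lambda_3$. The classes are: cluster (C) three positive eigenvalues, filament (F) two, wall (W) one, void (V) none; the volume fraction of a class is the probability of that class at a point. *)

theory Defs
  imports "HOL-Probability.Probability"
begin

text \<open>Gaussian variables and families. A Gaussian variable may be degenerate (almost surely
  constant); a finite family is jointly Gaussian if every linear combination is Gaussian.\<close>

definition gaussian_rv :: "'w measure \<Rightarrow> ('w \<Rightarrow> real) \<Rightarrow> bool" where
  "gaussian_rv M Y \<longleftrightarrow> Y \<in> borel_measurable M \<and>
     (\<exists>\<mu> s. (s > 0 \<and> distributed M lborel Y (normal_density \<mu> s)) \<or> (AE \<omega> in M. Y \<omega> = \<mu>))"

definition jointly_gaussian :: "'w measure \<Rightarrow> 'i set \<Rightarrow> ('i \<Rightarrow> 'w \<Rightarrow> real) \<Rightarrow> bool" where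
  "jointly_gaussian M I X \<longleftrightarrow> (\<forall>c :: 'i \<Rightarrow> real. gaussian_rv M (\<lambda>\<omega>. \<Sum>i\<in>I. c i * X i \<omega>))"

definition gaussian_field :: "'w measure \<Rightarrow> ('p \<Rightarrow> 'w \<Rightarrow> real) \<Rightarrow> bool" where
  "gaussian_field M f \<longleftrightarrow> (\<forall>I. finite I \<longrightarrow> jointly_gaussian M I f)"

definition zero_mean_field :: "'w measure \<Rightarrow> ('p \<Rightarrow> 'w \<Rightarrow> real) \<Rightarrow> bool" where
  "zero_mean_field M f \<longleftrightarrow> (\<forall>x. prob_space.expectation M (f x) = 0)"

text \<open>Homogeneity and isotropy: all finite-dimensional distributions are invariant under
  translations and rotations respectively.\<close>

definition field_invariant :: "'w measure \<Rightarrow> ('p \<Rightarrow> 'w \<Rightarrow> real) \<Rightarrow> ('p \<Rightarrow> 'p) \<Rightarrow> bool" where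
  "field_invariant M f T \<longleftrightarrow> (\<forall>I. finite I \<longrightarrow>
     distr M (\<Pi>\<^sub>M x\<in>I. borel) (\<lambda>\<omega>. \<lambda>x\<in>I. f (T x) \<omega>) =
     distr M (\<Pi>\<^sub>M x\<in>I. borel) (\<lambda>\<omega>. \<lambda>x\<in>I. f x \<omega>))"

definition homogeneous_field :: "'w measure \<Rightarrow> (real^3 \<Rightarrow> 'w \<Rightarrow> real) \<Rightarrow> bool" where
  "homogeneous_field M f \<longleftrightarrow> (\<forall>a. field_invariant M f (\<lambda>x. x + a))"

definition isotropic_field :: "'w measure \<Rightarrow> (real^3 \<Rightarrow> 'w \<Rightarrow> real) \<Rightarrow> bool" where
  "isotropic_field M f \<longleftrightarrow> (\<forall>Q. rotation_matrix Q \<longrightarrow> field_invariant M f (\<lambda>x. Q *v x))"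

definition partial :: "3 \<Rightarrow> (real^3 \<Rightarrow> real) \<Rightarrow> real^3 \<Rightarrow> real" where
  "partial i f x = deriv (\<lambda>t. f (x + t *\<^sub>R axis i 1)) 0"

definition twice_continuously_differentiable :: "(real^3 \<Rightarrow> real) \<Rightarrow> bool" where
  "twice_continuously_differentiable f \<longleftrightarrow>
     f differentiable_on UNIV \<and>
     (\<forall>i. partial i f differentiable_on UNIV) \<and>
     (\<forall>i j. continuous_on UNIV (partial i (partial j f)))"

definition hessian :: "(real^3 \<Rightarrow> real) \<Rightarrow> real^3 \<Rightarrow> real^3^3" where
  "hessian f x = (\<chi> i j. partial i (partial j f) x)"

text \<open>The potential, normalized so that its Laplacian is the density contrast, and its
  tidal tensor. The fields are taken to be smoothed, so that all realizations are twice
  continuously differentiable.\<close>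

definition potential_of ::
    "'w measure \<Rightarrow> (real^3 \<Rightarrow> 'w \<Rightarrow> real) \<Rightarrow> (real^3 \<Rightarrow> 'w \<Rightarrow> real) \<Rightarrow> bool" where
  "potential_of M \<delta> \<phi> \<longleftrightarrow> (\<forall>\<omega>\<in>space M.
     twice_continuously_differentiable (\<lambda>y. \<phi> y \<omega>) \<and>
     (\<forall>x. trace (hessian (\<lambda>y. \<phi> y \<omega>) x) = \<delta> x \<omega>))"

definition tidal_tensor :: "(real^3 \<Rightarrow> 'w \<Rightarrow> real) \<Rightarrow> real^3 \<Rightarrow> 'w \<Rightarrow> real^3^3" where
  "tidal_tensor \<phi> x \<omega> = hessian (\<lambda>y. \<phi> y \<omega>) x"

definition kronecker :: "'i \<Rightarrow> 'i \<Rightarrow> real" where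
  "kronecker i j = (if i = j then 1 else 0)"

text \<open>The one-point law of the tidal tensor. The equation for the Laplacian alone determines
  the potential only up to a harmonic random field; the isotropic Gaussian law with this
  covariance pins down the tidal tensor at a point.\<close>

definition isotropic_tidal_law :: "'w measure \<Rightarrow> real \<Rightarrow> ('w \<Rightarrow> real^3^3) \<Rightarrow> bool" where
  "isotropic_tidal_law M \<sigma> \<Psi> \<longleftrightarrow>
     jointly_gaussian M UNIV (\<lambda>(i, j) \<omega>. \<Psi> \<omega> $ i $ j) \<and>
     (\<forall>i j. prob_space.expectation M (\<lambda>\<omega>. \<Psi> \<omega> $ i $ j) = 0) \<and>
     (\<forall>i j k l. prob_space.expectation M (\<lambda>\<omega>. \<Psi> \<omega> $ i $ j * \<Psi> \<omega> $ k $ l) =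
        \<sigma>\<^sup>2 / 15 * (kronecker i j * kronecker k l + kronecker i k * kronecker j l
                   + kronecker i l * kronecker j k))"

text \<open>The eigenvalues, repeated according to multiplicity, in decreasing order. For symmetric
  matrices, the only ones of interest here, they exist and are unique.\<close>

definition ordered_eigenvalues :: "real^3^3 \<Rightarrow> real^3" where
  "ordered_eigenvalues A = (THE l. l $ 1 \<ge> l $ 2 \<and> l $ 2 \<ge> l $ 3 \<and>
     (\<forall>t. det (t *\<^sub>R mat 1 - A) = (t - l $ 1) * (t - l $ 2) * (t - l $ 3)))"

datatype web_type = Cluster | Filament | Wall | Void

fun num_eigenvalues_above :: "web_type \<Rightarrow> nat" where
  "num_eigenvalues_above Cluster = 3"
| "num_eigenvalues_above Filament = 2"
| "num_eigenvalues_above Wall = 1"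
| "num_eigenvalues_above Void = 0"

text \<open>The probability that exactly the number of eigenvalues prescribed by the class exceed
  the threshold \<open>\<theta>\<close>.\<close>

definition volume_fraction ::
    "'w measure \<Rightarrow> ('w \<Rightarrow> real^3^3) \<Rightarrow> real \<Rightarrow> web_type \<Rightarrow> real" where
  "volume_fraction M \<Psi> \<theta> c = measure M {\<omega> \<in> space M.
     card {i. ordered_eigenvalues (\<Psi> \<omega>) $ i > \<theta>} = num_eigenvalues_above c}"

end

theory Submission
  imports Defs
begin

text \<open>A centered Gaussian tensor \<open>\<Psi>\<close> has the same law as \<open>- \<Psi>\<close>, whose eigenvalues are the negatives
  of those of \<open>\<Psi>\<close>. So, as long as no eigenvalue vanishes, \<open>k\<close> and \<open>3 - k\<close> positive eigenvalues are
  equally likely. The trace is uncorrelated with, hence independent of, the traceless part, and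
  given the traceless part \<open>det \<Psi>\<close> is a cubic polynomial in the trace; a Gaussian variable almost
  surely avoids its roots, so \<open>det \<Psi> \<noteq> 0\<close> almost surely. Both statements about laws rest on the
  fact that the laws of all linear combinations determine the joint law.\<close>

section \<open>Characteristic functions determine joint laws\<close>

text \<open>The nine entries of \<open>\<Psi>\<close> have no joint density: the covariance gives
  \<open>\<Psi>\<close> an antisymmetric part of variance zero. Resampling only the trace avoids
  densities in several variables, since a single nondegenerate Gaussian variable suffices to move
  \<open>det \<Psi>\<close> off zero. Independence is not extracted from uncorrelatedness as a
  separate fact; it appears as an equality between the law of the family and that of a copy on a
  product space, where Fubini applies.

  Joint Gaussianity speaks only of linear combinations, so what is known is the characteristic
  function of each of them. Uniqueness for several coordinates is obtained from Levy's theorem on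
  the line by letting the other coordinates act as a bounded weight.

  Eigenvalues are given by a definite description, meaningful for symmetric matrices and with no
  evident measurability. Symmetry is therefore established for every realization, from smoothness of
  the potential, and eigenvalue counts are rewritten as sign conditions on the coefficients of the
  characteristic polynomial.\<close>

lemma weighted_law:
  fixes X w :: "'w \<Rightarrow> real" and m :: real
  assumes "prob_space M" and X [measurable]: "X \<in> borel_measurable M"
    and w [measurable]: "w \<in> borel_measurable M" and w0: "\<And>\<omega>. 0 \<le> w \<omega>" and wB: "\<And>\<omega>. w \<omega> \<le> B"
    and m: "m = (\<integral>\<omega>. w \<omega> \<partial>M)" and m0: "m > 0"
  defines "P \<equiv> distr (density M (\<lambda>\<omega>. ennreal (w \<omega> / m))) borel X"
  shows "real_distribution P"
    and "char P t = (CLINT \<omega>|M. complex_of_real (w \<omega>) * iexp (t * X \<omega>)) / m"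
    and "A \<in> sets borel \<Longrightarrow> measure P A = (\<integral>\<omega>. w \<omega> * indicator A (X \<omega>) \<partial>M) / m"
proof -
  interpret M: prob_space M by fact
  have int: "integrable M w"
    by (rule M.integrable_const_bound[of _ B]) (use w0 wB in auto)
  have em: "(\<integral>\<^sup>+\<omega>. ennreal (w \<omega> / m) \<partial>M) = 1"
    using int m m0 w0 by (subst nn_integral_eq_integral) auto
  have "prob_space (density M (\<lambda>\<omega>. ennreal (w \<omega> / m)))"
    by (rule prob_spaceI) (simp add: emeasure_density em)
  then show P: "real_distribution P"
    unfolding P_def by (intro real_distribution.intro prob_space.prob_space_distr real_distribution_axioms.intro) auto
  show "char P t = (CLINT \<omega>|M. complex_of_real (w \<omega>) * iexp (t * X \<omega>)) / m"
    unfolding char_def P_def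
    using w0 m0 by (subst integral_distr, simp, simp, subst integral_density)
      (auto simp: scaleR_conv_of_real)
  show "measure P A = (\<integral>\<omega>. w \<omega> * indicator A (X \<omega>) \<partial>M) / m" if A [measurable]: "A \<in> sets borel"
  proof -
    interpret P: real_distribution P by fact
    have "measure P A = (\<integral>x. indicator A x \<partial>P)" by simp
    also have "\<dots> = (\<integral>\<omega>. w \<omega> * indicator A (X \<omega>) \<partial>M) / m"
      unfolding P_def
      using w0 m0 by (subst integral_distr, simp, simp, subst integral_density) auto
    finally show ?thesis .
  qed
qed

text \<open>Levy uniqueness for the laws of \<open>X\<close> and \<open>Y\<close> under the measures
  reweighted by \<open>w / m\<close> and \<open>v / m\<close>. The case \<open>t = 0\<close> of the
  hypothesis shows that both weights have the same mass \<open>m\<close>. Mass zero cannot be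
  normalized, but then both weights vanish almost everywhere.\<close>

lemma nonneg_weight_char_unique:
  fixes X w :: "'a \<Rightarrow> real" and Y v :: "'b \<Rightarrow> real"
  assumes M: "prob_space M" and N: "prob_space N"
    and X [measurable]: "X \<in> borel_measurable M" and Y [measurable]: "Y \<in> borel_measurable N"
    and w [measurable]: "w \<in> borel_measurable M" and w0: "\<And>\<omega>. 0 \<le> w \<omega>" and wB: "\<And>\<omega>. w \<omega> \<le> B"
    and v [measurable]: "v \<in> borel_measurable N" and v0: "\<And>\<omega>. 0 \<le> v \<omega>" and vB: "\<And>\<omega>. v \<omega> \<le> B"
    and eq: "\<And>t. (CLINT \<omega>|M. complex_of_real (w \<omega>) * iexp (t * X \<omega>))
              = (CLINT \<omega>|N. complex_of_real (v \<omega>) * iexp (t * Y \<omega>))"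
    and A [measurable]: "A \<in> sets borel"
  shows "(\<integral>\<omega>. w \<omega> * indicator A (X \<omega>) \<partial>M) = (\<integral>\<omega>. v \<omega> * indicator A (Y \<omega>) \<partial>N)"
proof -
  interpret M: prob_space M by fact
  interpret N: prob_space N by fact
  define m where "m = (\<integral>\<omega>. w \<omega> \<partial>M)"
  have mv: "m = (\<integral>\<omega>. v \<omega> \<partial>N)"
    using eq[of 0] by (simp add: m_def)
  have iw: "integrable M w"
    by (rule M.integrable_const_bound[of _ B]) (use w0 wB in auto)
  have iv: "integrable N v"
    by (rule N.integrable_const_bound[of _ B]) (use v0 vB in auto)
  have "m \<ge> 0" using w0 by (simp add: m_def)
  show ?thesis
  proof (cases "m = 0")
    case True
    have "AE \<omega> in M. w \<omega> = 0"
      using True integral_nonneg_eq_0_iff_AE[OF iw] w0 by (auto simp: m_def)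
    then have 1: "(\<integral>\<omega>. w \<omega> * indicator A (X \<omega>) \<partial>M) = 0"
      by (intro integral_eq_zero_AE) auto
    have "AE \<omega> in N. v \<omega> = 0"
      using True mv integral_nonneg_eq_0_iff_AE[OF iv] v0 by auto
    then have "(\<integral>\<omega>. v \<omega> * indicator A (Y \<omega>) \<partial>N) = 0"
      by (intro integral_eq_zero_AE) auto
    with 1 show ?thesis by simp
  next
    case False
    with \<open>m \<ge> 0\<close> have m0: "m > 0" by simp
    note LM = weighted_law[OF M X w w0 wB m_def m0] and LN = weighted_law[OF N Y v v0 vB mv m0]
    have "distr (density M (\<lambda>\<omega>. ennreal (w \<omega> / m))) borel X = distr (density N (\<lambda>\<omega>. ennreal (v \<omega> / m))) borel Y"
      by (rule Levy_uniqueness[OF LM(1) LN(1)]) (rule ext, simp only: LM(2) LN(2) eq)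
    then show ?thesis
      using LM(3)[OF A] LN(3)[OF A] m0 by simp
  qed
qed

text \<open>Adding the bound \<open>B\<close> makes a signed weight nonnegative. The added term
  contributes \<open>B\<close> times the unweighted transform, which is why equality of the
  unweighted transforms is assumed as well.\<close>

lemma real_weight_char_unique:
  fixes X w :: "'a \<Rightarrow> real" and Y v :: "'b \<Rightarrow> real"
  assumes M: "prob_space M" and N: "prob_space N"
    and X [measurable]: "X \<in> borel_measurable M" and Y [measurable]: "Y \<in> borel_measurable N"
    and w [measurable]: "w \<in> borel_measurable M" and wB: "\<And>\<omega>. \<bar>w \<omega>\<bar> \<le> B"
    and v [measurable]: "v \<in> borel_measurable N" and vB: "\<And>\<omega>. \<bar>v \<omega>\<bar> \<le> B"
    and eq1: "\<And>t. (CLINT \<omega>|M. iexp (t * X \<omega>)) = (CLINT \<omega>|N. iexp (t * Y \<omega>))"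
    and eq: "\<And>t. (CLINT \<omega>|M. complex_of_real (w \<omega>) * iexp (t * X \<omega>))
              = (CLINT \<omega>|N. complex_of_real (v \<omega>) * iexp (t * Y \<omega>))"
    and A [measurable]: "A \<in> sets borel"
  shows "(\<integral>\<omega>. w \<omega> * indicator A (X \<omega>) \<partial>M) = (\<integral>\<omega>. v \<omega> * indicator A (Y \<omega>) \<partial>N)"
proof -
  interpret M: prob_space M by fact
  interpret N: prob_space N by fact
  have iM: "integrable M (\<lambda>\<omega>. w \<omega> * indicator A (X \<omega>))" "integrable M (\<lambda>\<omega>. indicator A (X \<omega>) :: real)"
      "integrable M (\<lambda>\<omega>. complex_of_real (w \<omega>) * iexp (t * X \<omega>))" "integrable M (\<lambda>\<omega>. iexp (t * X \<omega>))" for t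
    by (rule M.integrable_const_bound[of _ B] M.integrable_const_bound[of _ 1];
        use wB in \<open>auto simp: norm_mult abs_mult indicator_def intro: order_trans[OF abs_ge_zero]\<close>)+
  have iN: "integrable N (\<lambda>\<omega>. v \<omega> * indicator A (Y \<omega>))" "integrable N (\<lambda>\<omega>. indicator A (Y \<omega>) :: real)"
      "integrable N (\<lambda>\<omega>. complex_of_real (v \<omega>) * iexp (t * Y \<omega>))" "integrable N (\<lambda>\<omega>. iexp (t * Y \<omega>))" for t
    by (rule N.integrable_const_bound[of _ B] N.integrable_const_bound[of _ 1];
        use vB in \<open>auto simp: norm_mult abs_mult indicator_def intro: order_trans[OF abs_ge_zero]\<close>)+
  have "(\<integral>\<omega>. (w \<omega> + B) * indicator A (X \<omega>) \<partial>M) = (\<integral>\<omega>. (v \<omega> + B) * indicator A (Y \<omega>) \<partial>N)"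
  proof (rule nonneg_weight_char_unique[OF M N X Y, where B = "2 * B"])
    show "0 \<le> w \<omega> + B" "w \<omega> + B \<le> 2 * B" for \<omega> using wB[of \<omega>] by auto
    show "0 \<le> v \<omega> + B" "v \<omega> + B \<le> 2 * B" for \<omega> using vB[of \<omega>] by auto
    show "(CLINT \<omega>|M. complex_of_real (w \<omega> + B) * iexp (t * X \<omega>))
              = (CLINT \<omega>|N. complex_of_real (v \<omega> + B) * iexp (t * Y \<omega>))" for t
      unfolding of_real_add distrib_right
      using iM(3,4)[of t] iN(3,4)[of t] eq[of t] eq1[of t]
      by (subst (1 2) Bochner_Integration.integral_add) auto
  qed auto
  moreover have "(\<integral>\<omega>. 1 * indicator A (X \<omega>) \<partial>M) = (\<integral>\<omega>. 1 * indicator A (Y \<omega>) \<partial>N :: real)"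
    by (rule nonneg_weight_char_unique[OF M N X Y, where B = 1]) (use eq1 in auto)
  ultimately show ?thesis
    using iM(1,2) iN(1,2) by (simp add: distrib_right)
qed

text \<open>The exponential is complex too, so real parts of the weighted transform do not isolate
  \<open>Re (w \<omega>)\<close>. Conjugating the integrand at \<open>-t\<close> restores the
  frequency \<open>t\<close> and conjugates the weight, so the hypotheses at \<open>t\<close> and
  \<open>-t\<close> together yield the transforms weighted by the real and the imaginary
  part.\<close>

lemma complex_weight_char_unique:
  fixes X :: "'a \<Rightarrow> real" and Y :: "'b \<Rightarrow> real" and w :: "'a \<Rightarrow> complex" and v :: "'b \<Rightarrow> complex"
  assumes M: "prob_space M" and N: "prob_space N"
    and X [measurable]: "X \<in> borel_measurable M" and Y [measurable]: "Y \<in> borel_measurable N"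
    and w [measurable]: "w \<in> borel_measurable M" and wB: "\<And>\<omega>. norm (w \<omega>) \<le> B"
    and v [measurable]: "v \<in> borel_measurable N" and vB: "\<And>\<omega>. norm (v \<omega>) \<le> B"
    and eq1: "\<And>t. (CLINT \<omega>|M. iexp (t * X \<omega>)) = (CLINT \<omega>|N. iexp (t * Y \<omega>))"
    and eq: "\<And>t. (CLINT \<omega>|M. w \<omega> * iexp (t * X \<omega>)) = (CLINT \<omega>|N. v \<omega> * iexp (t * Y \<omega>))"
    and A [measurable]: "A \<in> sets borel"
  shows "(CLINT \<omega>|M. w \<omega> * indicator A (X \<omega>)) = (CLINT \<omega>|N. v \<omega> * indicator A (Y \<omega>))"
proof -
  interpret M: prob_space M by fact
  interpret N: prob_space N by fact
  have iM: "integrable M (\<lambda>\<omega>. w \<omega> * indicator A (X \<omega>))"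
      "integrable M (\<lambda>\<omega>. w \<omega> * iexp (t * X \<omega>))" "integrable M (\<lambda>\<omega>. iexp (t * X \<omega>))" for t
    by (rule M.integrable_const_bound[of _ B] M.integrable_const_bound[of _ 1];
        use wB in \<open>auto simp: norm_mult indicator_def intro: order_trans[OF norm_ge_zero]\<close>)+
  have iN: "integrable N (\<lambda>\<omega>. v \<omega> * indicator A (Y \<omega>))"
      "integrable N (\<lambda>\<omega>. v \<omega> * iexp (t * Y \<omega>))" "integrable N (\<lambda>\<omega>. iexp (t * Y \<omega>))" for t
    by (rule N.integrable_const_bound[of _ B] N.integrable_const_bound[of _ 1];
        use vB in \<open>auto simp: norm_mult indicator_def intro: order_trans[OF norm_ge_zero]\<close>)+
  have re: "complex_of_real (Re z) * iexp (t * x) = (z * iexp (t * x) + cnj (z * iexp ((-t) * x))) / 2"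
    and im: "complex_of_real (Im z) * iexp (t * x) = (z * iexp (t * x) - cnj (z * iexp ((-t) * x))) / (2 * \<i>)"
    for z t x
  proof -
    have c: "cnj (iexp ((-t) * x)) = iexp (t * x)" by (simp add: exp_cnj)
    have "complex_of_real (Re z) = (z + cnj z) / 2" "complex_of_real (Im z) = (z - cnj z) / (2 * \<i>)"
      by (auto simp: complex_eq_iff)
    then show "complex_of_real (Re z) * iexp (t * x) = (z * iexp (t * x) + cnj (z * iexp ((-t) * x))) / 2"
      "complex_of_real (Im z) * iexp (t * x) = (z * iexp (t * x) - cnj (z * iexp ((-t) * x))) / (2 * \<i>)"
      unfolding complex_cnj_mult c
      by (simp_all only: distrib_right left_diff_distrib times_divide_eq_left)
  qed
  have Re: "(\<integral>\<omega>. Re (w \<omega>) * indicator A (X \<omega>) \<partial>M) = (\<integral>\<omega>. Re (v \<omega>) * indicator A (Y \<omega>) \<partial>N)"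
  proof (rule real_weight_char_unique[OF M N X Y, where B = B])
    show "(CLINT \<omega>|M. complex_of_real (Re (w \<omega>)) * iexp (t * X \<omega>))
        = (CLINT \<omega>|N. complex_of_real (Re (v \<omega>)) * iexp (t * Y \<omega>))" for t
      unfolding re using iM(2)[of t] iN(2)[of t] iM(2)[of "-t"] iN(2)[of "-t"] eq[of t] eq[of "-t"]
      by (simp add: Bochner_Integration.integral_add del: complex_cnj_mult)
  qed (use wB vB abs_Re_le_cmod order_trans eq1 in \<open>auto, blast+\<close>)
  have Im: "(\<integral>\<omega>. Im (w \<omega>) * indicator A (X \<omega>) \<partial>M) = (\<integral>\<omega>. Im (v \<omega>) * indicator A (Y \<omega>) \<partial>N)"
  proof (rule real_weight_char_unique[OF M N X Y, where B = B])
    show "(CLINT \<omega>|M. complex_of_real (Im (w \<omega>)) * iexp (t * X \<omega>))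
        = (CLINT \<omega>|N. complex_of_real (Im (v \<omega>)) * iexp (t * Y \<omega>))" for t
      unfolding im using iM(2)[of t] iN(2)[of t] iM(2)[of "-t"] iN(2)[of "-t"] eq[of t] eq[of "-t"]
      by (simp add: Bochner_Integration.integral_diff del: complex_cnj_mult)
  qed (use wB vB abs_Im_le_cmod order_trans eq1 in \<open>auto, blast+\<close>)
  have ri: "Re (z * indicator A x) = Re z * indicator A x" "Im (z * indicator A x) = Im z * indicator A x"
    for z :: complex and x :: real by (auto simp: indicator_def)
  show ?thesis
    by (rule complex_eqI)
       (use Re Im iM(1) iN(1) in \<open>simp_all only: integral_Re[symmetric] integral_Im[symmetric] ri\<close>)
qed

text \<open>Boxes generate the product sigma-algebra and are closed under intersection, so it
  suffices to compare their probabilities, which are expectations of products of indicators.\<close>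

lemma char_determines_joint_law:
  fixes X :: "'i \<Rightarrow> 'a \<Rightarrow> real" and Y :: "'i \<Rightarrow> 'b \<Rightarrow> real"
  assumes M: "prob_space M" and N: "prob_space N" and fin: "finite I"
    and X: "\<And>i. i \<in> I \<Longrightarrow> X i \<in> borel_measurable M"
    and Y: "\<And>i. i \<in> I \<Longrightarrow> Y i \<in> borel_measurable N"
    and eq: "\<And>c. (CLINT \<omega>|M. iexp (\<Sum>i\<in>I. c i * X i \<omega>)) = (CLINT \<omega>|N. iexp (\<Sum>i\<in>I. c i * Y i \<omega>))"
  shows "distr M (\<Pi>\<^sub>M i\<in>I. borel) (\<lambda>\<omega>. \<lambda>i\<in>I. X i \<omega>) = distr N (\<Pi>\<^sub>M i\<in>I. borel) (\<lambda>\<omega>. \<lambda>i\<in>I. Y i \<omega>)"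
proof -
  interpret M: prob_space M by fact
  interpret N: prob_space N by fact
  have mX: "(\<lambda>\<omega>. \<Sum>i\<in>I. c i * X i \<omega>) \<in> borel_measurable M" for c
    using X by (intro borel_measurable_sum) auto
  have mY: "(\<lambda>\<omega>. \<Sum>i\<in>I. c i * Y i \<omega>) \<in> borel_measurable N" for c
    using Y by (intro borel_measurable_sum) auto
  \<comment> \<open>The coefficient vector with \<open>t\<close> at \<open>j\<close> and zero
    elsewhere isolates one coordinate; this supplies the unweighted transforms.\<close>
  have eq1: "(CLINT \<omega>|M. iexp (t * X j \<omega>)) = (CLINT \<omega>|N. iexp (t * Y j \<omega>))" if "j \<in> I" for j t
  proof -
    have *: "(\<Sum>i\<in>I. (if i = j then t else 0) * f i) = t * f j" for f :: "'i \<Rightarrow> real"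
      using that fin by (simp add: if_distrib[of "\<lambda>x. x * _"] sum.delta cong: if_cong)
    show ?thesis using eq[of "\<lambda>i. if i = j then t else 0"] unfolding * .
  qed
  \<comment> \<open>The factors \<open>iexp\<close> are traded for indicators one coordinate at a time: all the remaining
    factors serve as the complex weight to which the one-dimensional uniqueness is applied.\<close>
  have main: "\<forall>c. (CLINT \<omega>|M. iexp (\<Sum>i\<in>I. c i * X i \<omega>) * (\<Prod>j\<in>J. indicator (A j) (X j \<omega>)))
      = (CLINT \<omega>|N. iexp (\<Sum>i\<in>I. c i * Y i \<omega>) * (\<Prod>j\<in>J. indicator (A j) (Y j \<omega>)))"
    if A: "\<And>i. i \<in> I \<Longrightarrow> A i \<in> sets borel" and "J \<subseteq> I" for A J
    using finite_subset[OF \<open>J \<subseteq> I\<close> fin] \<open>J \<subseteq> I\<close>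
  proof (induction J rule: finite_induct)
    case empty
    show ?case using eq by simp
  next
    case (insert j J)
    then have j: "j \<in> I" and JI: "J \<subseteq> I" by auto
    note [measurable] = X[OF j] Y[OF j] A[OF j]
    have [measurable]: "(\<lambda>\<omega>. \<Prod>j\<in>J. indicator (A j) (X j \<omega>) :: complex) \<in> borel_measurable M"
      "(\<lambda>\<omega>. \<Prod>j\<in>J. indicator (A j) (Y j \<omega>) :: complex) \<in> borel_measurable N"
      using JI X Y A by (auto intro!: borel_measurable_prod borel_measurable_indicator' dest!: subsetD)
    \<comment> \<open>The factor for the coordinate being treated is absorbed by raising its
      coefficient by \<open>t\<close>. Hence the induction hypothesis has to hold for all
      \<open>c\<close> at once.\<close>
    have shift: "iexp (\<Sum>i\<in>I. c i * x i) * p * iexp (t * x j) = iexp (\<Sum>i\<in>I. (c(j := c j + t)) i * x i) * p"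
      for c x :: "'i \<Rightarrow> real" and p t
    proof -
      have "(\<Sum>i\<in>I. (c(j := c j + t)) i * x i) = (\<Sum>i\<in>I. c i * x i + (if i = j then t * x i else 0))"
        by (intro sum.cong) (auto simp: algebra_simps)
      also have "\<dots> = (\<Sum>i\<in>I. c i * x i) + t * x j"
        using j fin by (simp add: sum.distrib)
      finally show ?thesis by (simp add: exp_add algebra_simps del: of_real_sum)
    qed
    have nm: "norm (\<Prod>j\<in>J. indicator (A j) (x j) :: complex) \<le> 1" for x
      unfolding prod_norm[symmetric] by (intro prod_le_1) (auto simp: indicator_def)
    show ?case
    proof
      fix c
      note [measurable] = mX[of c] mY[of c]
      have "(CLINT \<omega>|M. (iexp (\<Sum>i\<in>I. c i * X i \<omega>) * (\<Prod>j\<in>J. indicator (A j) (X j \<omega>))) * indicator (A j) (X j \<omega>))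
        = (CLINT \<omega>|N. (iexp (\<Sum>i\<in>I. c i * Y i \<omega>) * (\<Prod>j\<in>J. indicator (A j) (Y j \<omega>))) * indicator (A j) (Y j \<omega>))"
      proof (rule complex_weight_char_unique[OF M N, where B = 1])
        show "(CLINT \<omega>|M. (iexp (\<Sum>i\<in>I. c i * X i \<omega>) * (\<Prod>j\<in>J. indicator (A j) (X j \<omega>))) * iexp (t * X j \<omega>))
          = (CLINT \<omega>|N. (iexp (\<Sum>i\<in>I. c i * Y i \<omega>) * (\<Prod>j\<in>J. indicator (A j) (Y j \<omega>))) * iexp (t * Y j \<omega>))" for t
          unfolding shift[of _ "\<lambda>i. X i \<omega>" for \<omega>] shift[of _ "\<lambda>i. Y i \<omega>" for \<omega>]
          using insert.IH[OF JI] by blast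
        show "(CLINT \<omega>|M. iexp (t * X j \<omega>)) = (CLINT \<omega>|N. iexp (t * Y j \<omega>))" for t by (rule eq1[OF j])
      qed (use nm in \<open>simp_all add: norm_mult del: of_real_sum\<close>)
      then show "(CLINT \<omega>|M. iexp (\<Sum>i\<in>I. c i * X i \<omega>) * (\<Prod>j\<in>insert j J. indicator (A j) (X j \<omega>)))
        = (CLINT \<omega>|N. iexp (\<Sum>i\<in>I. c i * Y i \<omega>) * (\<Prod>j\<in>insert j J. indicator (A j) (Y j \<omega>)))"
        using insert.hyps by (simp add: mult.commute mult.left_commute del: of_real_sum)
    qed
  qed
  have prob: "measure M (((\<lambda>\<omega>. \<lambda>i\<in>I. X i \<omega>) -` (Pi\<^sub>E I A)) \<inter> space M)
     = measure N (((\<lambda>\<omega>. \<lambda>i\<in>I. Y i \<omega>) -` (Pi\<^sub>E I A)) \<inter> space N)"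
    if A: "\<And>i. i \<in> I \<Longrightarrow> A i \<in> sets borel" for A
  proof -
    have ind: "(\<Prod>j\<in>I. indicator (A j) (x j) :: complex) = of_real (indicator {f. f \<in> Pi\<^sub>E I A} (\<lambda>i\<in>I. x i))" for x
      using fin by (auto simp: indicator_def prod_eq_1_iff intro!: prod.neutral)
    have *: "(CLINT \<omega>|L. (\<Prod>j\<in>I. indicator (A j) (Z j \<omega>)))
        = of_real (measure L (((\<lambda>\<omega>. \<lambda>i\<in>I. Z i \<omega>) -` (Pi\<^sub>E I A)) \<inter> space L))"
      if "prob_space L" for L :: "'c measure" and Z
    proof -
      have "(CLINT \<omega>|L. (\<Prod>j\<in>I. indicator (A j) (Z j \<omega>)))
         = (CLINT \<omega>|L. of_real (indicator ((\<lambda>\<omega>. \<lambda>i\<in>I. Z i \<omega>) -` (Pi\<^sub>E I A)) \<omega>))"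
        unfolding ind by (intro Bochner_Integration.integral_cong) (auto simp: indicator_def)
      then show ?thesis by simp
    qed
    show ?thesis
      \<comment> \<open>Zero coefficients remove the exponential and leave only the product of
        indicators.\<close>
      using spec[OF main[OF A order.refl], where x = "\<lambda>_. 0"] *[OF M, of X] *[OF N, of Y] by simp
  qed
  note [measurable] = X Y
  have mX': "(\<lambda>\<omega>. \<lambda>i\<in>I. X i \<omega>) \<in> measurable M (\<Pi>\<^sub>M i\<in>I. borel)"
    and mY': "(\<lambda>\<omega>. \<lambda>i\<in>I. Y i \<omega>) \<in> measurable N (\<Pi>\<^sub>M i\<in>I. borel)"
    by (auto intro!: measurable_restrict X Y)
  show ?thesis
  proof (rule measure_eqI_PiM_finite[OF fin, where M = "\<lambda>_. borel" and A = "\<lambda>_. Pi\<^sub>E I (\<lambda>_. UNIV)"])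
    fix A :: "'i \<Rightarrow> real set" assume A: "\<And>i. i \<in> I \<Longrightarrow> A i \<in> sets borel"
    then have "Pi\<^sub>E I A \<in> sets (\<Pi>\<^sub>M i\<in>I. borel)" by (intro sets_PiM_I_finite fin) auto
    then show "emeasure (distr M (\<Pi>\<^sub>M i\<in>I. borel) (\<lambda>\<omega>. \<lambda>i\<in>I. X i \<omega>)) (Pi\<^sub>E I A) =
      emeasure (distr N (\<Pi>\<^sub>M i\<in>I. borel) (\<lambda>\<omega>. \<lambda>i\<in>I. Y i \<omega>)) (Pi\<^sub>E I A)"
      using prob[OF A]
      by (simp add: emeasure_distr mX' mY' M.emeasure_eq_measure N.emeasure_eq_measure)
  next
    show "range (\<lambda>_::nat. Pi\<^sub>E I (\<lambda>_. UNIV)) \<subseteq> prod_algebra I (\<lambda>_. borel :: real measure)"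
      using fin by (auto intro!: prod_algebraI_finite)
    show "(\<Union>i::nat. Pi\<^sub>E I (\<lambda>_. UNIV)) = space (\<Pi>\<^sub>M i\<in>I. (borel :: real measure))"
      by (simp add: space_PiM)
    interpret D: prob_space "distr M (\<Pi>\<^sub>M i\<in>I. borel) (\<lambda>\<omega>. \<lambda>i\<in>I. X i \<omega>)"
      by (rule M.prob_space_distr[OF mX'])
    show "emeasure (distr M (\<Pi>\<^sub>M i\<in>I. borel) (\<lambda>\<omega>. \<lambda>i\<in>I. X i \<omega>)) (Pi\<^sub>E I (\<lambda>_. UNIV)) \<noteq> \<infinity>"
      by simp
  qed auto
qed

section \<open>Centered Gaussian families\<close>

text \<open>The degenerate case obeys the same formula with variance zero. It does occur: the
  combination \<open>\<Psi>$1$2 - \<Psi>$2$1\<close> has variance zero under the isotropic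
  covariance.\<close>

lemma centered_gaussian_rv:
  assumes M: "prob_space M" and Y: "gaussian_rv M Y" and E0: "(\<integral>\<omega>. Y \<omega> \<partial>M) = 0"
  shows "(CLINT \<omega>|M. iexp (Y \<omega>)) = exp (- (\<integral>\<omega>. (Y \<omega>)\<^sup>2 \<partial>M) / 2)"
proof -
  interpret M: prob_space M by fact
  have [measurable]: "Y \<in> borel_measurable M" using Y by (simp add: gaussian_rv_def)
  from Y consider \<mu> s where "s > 0" "distributed M lborel Y (normal_density \<mu> s)"
    | \<mu> where "AE \<omega> in M. Y \<omega> = \<mu>"
    unfolding gaussian_rv_def by blast
  then show ?thesis
  proof cases
    case 1
    have "\<mu> = 0" using M.normal_distributed_expectation[OF 1] E0 by simp
    have v: "(\<integral>\<omega>. (Y \<omega>)\<^sup>2 \<partial>M) = s\<^sup>2"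
      using M.normal_distributed_variance[OF 1] E0 by simp
    have D: "distributed M lborel (\<lambda>\<omega>. Y \<omega> / s) std_normal_density"
      using 1 M.normal_standard_normal_convert[OF 1(1), of Y \<mu>] \<open>\<mu> = 0\<close> by simp
    \<comment> \<open>The standard normal characteristic function at \<open>s\<close> is that of
      \<open>Y / s\<close> at \<open>s\<close>, hence that of \<open>Y\<close> at 1.\<close>
    have "complex_of_real (exp (- s\<^sup>2 / 2)) = char std_normal_distribution s"
      by (simp add: char_std_normal_distribution)
    also have "\<dots> = char (distr M lborel (\<lambda>\<omega>. Y \<omega> / s)) s"
      using D by (simp add: distributed_def)
    also have "\<dots> = (CLINT \<omega>|M. iexp (s * (Y \<omega> / s)))"
      unfolding char_def by (subst integral_distr) auto
    also have "\<dots> = (CLINT \<omega>|M. iexp (Y \<omega>))" using 1(1) by simp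
    finally show ?thesis by (simp add: v)
  next
    case 2
    have "(\<integral>\<omega>. Y \<omega> \<partial>M) = (\<integral>\<omega>. \<mu> \<partial>M)" by (rule integral_cong_AE) (use 2 in auto)
    then have Y0: "AE \<omega> in M. Y \<omega> = 0" using E0 2 by (simp add: M.prob_space)
    have "(\<integral>\<omega>. (Y \<omega>)\<^sup>2 \<partial>M) = 0" using Y0 by (intro integral_eq_zero_AE) auto
    moreover have "(CLINT \<omega>|M. iexp (Y \<omega>)) = (CLINT \<omega>|M. 1)"
      by (rule integral_cong_AE) (use Y0 in auto)
    ultimately show ?thesis by (simp add: M.prob_space)
  qed
qed

lemma gaussian_rv_integrable:
  assumes M: "prob_space M" and Y: "gaussian_rv M Y"
  shows "integrable M Y" and "integrable M (\<lambda>\<omega>. (Y \<omega>)\<^sup>2)"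
proof -
  interpret M: prob_space M by fact
  have [measurable]: "Y \<in> borel_measurable M" using Y by (simp add: gaussian_rv_def)
  from Y consider \<mu> s where "s > 0" "distributed M lborel Y (normal_density \<mu> s)"
    | \<mu> where "AE \<omega> in M. Y \<omega> = \<mu>"
    unfolding gaussian_rv_def by blast
  then have "integrable M Y \<and> integrable M (\<lambda>\<omega>. (Y \<omega>)\<^sup>2)"
  proof cases
    case 1
    have 1: "integrable M (\<lambda>\<omega>. (Y \<omega> - \<mu>) ^ k)" for k
      using integrable_normal_moment[OF 1(1), of \<mu> k]
        distributed_integrable[OF 1(2), of "\<lambda>x. (x - \<mu>) ^ k"] by simp
    have "Y = (\<lambda>\<omega>. (Y \<omega> - \<mu>) ^ 1 + \<mu>)" by simp
    moreover have "(\<lambda>\<omega>. (Y \<omega>)\<^sup>2) = (\<lambda>\<omega>. (Y \<omega> - \<mu>) ^ 2 + (2 * \<mu>) * (Y \<omega> - \<mu>) ^ 1 + \<mu>\<^sup>2)"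
      by (simp add: power2_eq_square algebra_simps)
    moreover have "integrable M (\<lambda>\<omega>. (Y \<omega> - \<mu>) ^ 1 + \<mu>)"
      "integrable M (\<lambda>\<omega>. (Y \<omega> - \<mu>) ^ 2 + (2 * \<mu>) * (Y \<omega> - \<mu>) ^ 1 + \<mu>\<^sup>2)"
      by (intro Bochner_Integration.integrable_add integrable_mult_right M.integrable_const 1)+
    ultimately show ?thesis by metis
  next
    case 2
    have "integrable M (\<lambda>_. \<mu>)" "integrable M (\<lambda>_. \<mu>\<^sup>2)" by simp_all
    moreover have "integrable M Y \<longleftrightarrow> integrable M (\<lambda>_. \<mu>)"
      by (rule integrable_cong_AE) (use 2 in auto)
    moreover have "integrable M (\<lambda>\<omega>. (Y \<omega>)\<^sup>2) \<longleftrightarrow> integrable M (\<lambda>_. \<mu>\<^sup>2)"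
      by (rule integrable_cong_AE) (use 2 in auto)
    ultimately show ?thesis by simp
  qed
  then show "integrable M Y" and "integrable M (\<lambda>\<omega>. (Y \<omega>)\<^sup>2)" by auto
qed

lemma integrable_mult_of_squares:
  fixes f g :: "'a \<Rightarrow> real"
  assumes [measurable]: "f \<in> borel_measurable M" "g \<in> borel_measurable M"
    and "integrable M (\<lambda>x. (f x)\<^sup>2)" "integrable M (\<lambda>x. (g x)\<^sup>2)"
  shows "integrable M (\<lambda>x. f x * g x)"
proof (rule Bochner_Integration.integrable_bound)
  show "integrable M (\<lambda>x. (f x)\<^sup>2 + (g x)\<^sup>2)" using assms by simp
  have "\<bar>f x * g x\<bar> \<le> (f x)\<^sup>2 + (g x)\<^sup>2" for x
  proof -
    have "2 * (\<bar>f x\<bar> * \<bar>g x\<bar>) \<le> (f x)\<^sup>2 + (g x)\<^sup>2"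
      using sum_squares_bound[of "\<bar>f x\<bar>" "\<bar>g x\<bar>"] by simp
    moreover have "0 \<le> \<bar>f x\<bar> * \<bar>g x\<bar>" by simp
    ultimately show ?thesis unfolding abs_mult by linarith
  qed
  then show "AE x in M. norm (f x * g x) \<le> norm ((f x)\<^sup>2 + (g x)\<^sup>2)"
    by (auto intro!: AE_I2 order_trans[OF _ abs_ge_self])
qed auto

locale centered_gaussian_family = prob_space M for M :: "'w measure" +
  fixes I :: "'i set" and X :: "'i \<Rightarrow> 'w \<Rightarrow> real"
  assumes fin: "finite I" and jg: "jointly_gaussian M I X"
    and mean0: "i \<in> I \<Longrightarrow> expectation (X i) = 0"
begin

lemma gaussian_rv_component: "gaussian_rv M (X i)" if "i \<in> I"
proof -
  have "gaussian_rv M (\<lambda>\<omega>. \<Sum>j\<in>I. (if j = i then 1 else 0) * X j \<omega>)"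
    using jg unfolding jointly_gaussian_def by (rule spec)
  then show ?thesis using that fin by (simp add: if_distrib[of "\<lambda>x. x * _"] cong: if_cong)
qed

lemma gaussian_rv_combination: "gaussian_rv M (\<lambda>\<omega>. \<Sum>i\<in>I. c i * X i \<omega>)"
  using jg unfolding jointly_gaussian_def by blast

lemma measurable_component [measurable (raw)]: "i \<in> I \<Longrightarrow> X i \<in> borel_measurable M"
  using gaussian_rv_component by (auto simp: gaussian_rv_def)

lemma char_combination:
  "(CLINT \<omega>|M. iexp (\<Sum>i\<in>I. c i * X i \<omega>)) = exp (- expectation (\<lambda>\<omega>. (\<Sum>i\<in>I. c i * X i \<omega>)\<^sup>2) / 2)"
proof (rule centered_gaussian_rv[OF prob_space_axioms gaussian_rv_combination])
  have "integrable M (X i)" if "i \<in> I" for i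
    using gaussian_rv_integrable(1)[OF prob_space_axioms gaussian_rv_component[OF that]] .
  then show "expectation (\<lambda>\<omega>. \<Sum>i\<in>I. c i * X i \<omega>) = 0"
    by (simp add: mean0)
qed

text \<open>By \<open>char_combination\<close> the law depends only on the quadratic form sending
  \<open>c\<close> to the second moment of the combination, and this form is even in
  \<open>c\<close>.\<close>

lemma law_symmetric:
  "distr M (\<Pi>\<^sub>M i\<in>I. borel) (\<lambda>\<omega>. \<lambda>i\<in>I. X i \<omega>) = distr M (\<Pi>\<^sub>M i\<in>I. borel) (\<lambda>\<omega>. \<lambda>i\<in>I. - X i \<omega>)"
proof (rule char_determines_joint_law[OF prob_space_axioms prob_space_axioms fin])
  fix c
  have "(\<Sum>i\<in>I. c i * - X i \<omega>) = (\<Sum>i\<in>I. (- c i) * X i \<omega>)" for \<omega> by simp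
  moreover have "(\<Sum>i\<in>I. (- c i) * X i \<omega>)\<^sup>2 = (\<Sum>i\<in>I. c i * X i \<omega>)\<^sup>2" for \<omega>
    by (simp add: sum_negf)
  ultimately show "(CLINT \<omega>|M. iexp (\<Sum>i\<in>I. c i * X i \<omega>)) = (CLINT \<omega>|M. iexp (\<Sum>i\<in>I. c i * - X i \<omega>))"
    by (simp only: char_combination)
qed auto

text \<open>\<open>X - a T\<close> is uncorrelated with \<open>T\<close>, so \<open>T\<close> may be replaced by an independent Gaussian
  variable of the same variance.\<close>

lemma law_resample:
  fixes d a :: "'i \<Rightarrow> real"
  defines "T \<equiv> \<lambda>\<omega>. \<Sum>i\<in>I. d i * X i \<omega>"
  assumes \<tau>: "\<tau> > 0" and var: "expectation (\<lambda>\<omega>. (T \<omega>)\<^sup>2) = \<tau>\<^sup>2"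
    and cov: "\<And>i. i \<in> I \<Longrightarrow> expectation (\<lambda>\<omega>. T \<omega> * X i \<omega>) = a i * \<tau>\<^sup>2"
  shows "distr M (\<Pi>\<^sub>M i\<in>I. borel) (\<lambda>\<omega>. \<lambda>i\<in>I. X i \<omega>) =
    distr (M \<Otimes>\<^sub>M density lborel (normal_density 0 \<tau>)) (\<Pi>\<^sub>M i\<in>I. borel)
      (\<lambda>p. \<lambda>i\<in>I. X i (fst p) - a i * T (fst p) + a i * snd p)"
proof -
  define \<nu> where "\<nu> = density lborel (normal_density 0 \<tau>)"
  interpret \<nu>: prob_space \<nu> unfolding \<nu>_def by (rule prob_space_normal_density[OF \<tau>])
  have s\<nu> [measurable_cong]: "sets \<nu> = sets borel" by (simp add: \<nu>_def)
  interpret P: pair_prob_space M \<nu> ..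
  have T [measurable]: "T \<in> borel_measurable M" unfolding T_def by measurable
  have T2: "integrable M (\<lambda>\<omega>. (T \<omega>)\<^sup>2)"
    unfolding T_def using gaussian_rv_integrable(2)[OF prob_space_axioms gaussian_rv_combination] .
  show ?thesis unfolding \<nu>_def[symmetric]
  proof (rule char_determines_joint_law[OF prob_space_axioms P.prob_space_axioms fin])
    fix c :: "'i \<Rightarrow> real"
    define Y where "Y = (\<lambda>\<omega>. \<Sum>i\<in>I. c i * X i \<omega>)"
    \<comment> \<open>Since \<open>a i\<close> is the regression coefficient of \<open>X i\<close>
      on \<open>T\<close>, this is the regression coefficient of the combination \<open>Y\<close> on
      \<open>T\<close>.\<close>
    define \<alpha> where "\<alpha> = (\<Sum>i\<in>I. c i * a i)"
    have Y [measurable]: "Y \<in> borel_measurable M" unfolding Y_def by measurable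
    have Y2: "integrable M (\<lambda>\<omega>. (Y \<omega>)\<^sup>2)"
      unfolding Y_def using gaussian_rv_integrable(2)[OF prob_space_axioms gaussian_rv_combination] .
    have TY: "integrable M (\<lambda>\<omega>. T \<omega> * Y \<omega>)"
      by (rule integrable_mult_of_squares) (use T2 Y2 in auto)
    have iTX: "integrable M (\<lambda>\<omega>. T \<omega> * X i \<omega>)" if "i \<in> I" for i
      using that T2 gaussian_rv_integrable(2)[OF prob_space_axioms gaussian_rv_component[OF that]]
      by (intro integrable_mult_of_squares) auto
    have "expectation (\<lambda>\<omega>. T \<omega> * Y \<omega>) = expectation (\<lambda>\<omega>. \<Sum>i\<in>I. c i * (T \<omega> * X i \<omega>))"
      unfolding Y_def by (simp add: sum_distrib_left mult_ac)
    also have "\<dots> = (\<Sum>i\<in>I. c i * (a i * \<tau>\<^sup>2))"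
      using iTX by (subst Bochner_Integration.integral_sum) (auto simp: cov)
    finally have ETY: "expectation (\<lambda>\<omega>. T \<omega> * Y \<omega>) = \<alpha> * \<tau>\<^sup>2"
      by (simp add: \<alpha>_def sum_distrib_right mult.assoc)
    have "(\<lambda>\<omega>. (Y \<omega> - \<alpha> * T \<omega>)\<^sup>2) = (\<lambda>\<omega>. (Y \<omega>)\<^sup>2 - (2 * \<alpha>) * (T \<omega> * Y \<omega>) + \<alpha>\<^sup>2 * (T \<omega>)\<^sup>2)"
      by (auto simp: power2_eq_square algebra_simps)
    \<comment> \<open>The cross term \<open>- 2 * \<alpha>\<^sup>2 * \<tau>\<^sup>2\<close> and the
      square \<open>\<alpha>\<^sup>2 * \<tau>\<^sup>2\<close> combine: removing the regression on
      \<open>T\<close> lowers the variance by exactly the amount that the independent Gaussian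
      variable restores.\<close>
    then have E: "expectation (\<lambda>\<omega>. (Y \<omega> - \<alpha> * T \<omega>)\<^sup>2) = expectation (\<lambda>\<omega>. (Y \<omega>)\<^sup>2) - \<alpha>\<^sup>2 * \<tau>\<^sup>2"
      using Y2 TY T2 by (simp add: Bochner_Integration.integral_add Bochner_Integration.integral_diff ETY var)
        (simp add: power2_eq_square)
    have comb: "Y \<omega> - \<alpha> * T \<omega> = (\<Sum>i\<in>I. (c i - \<alpha> * d i) * X i \<omega>)" for \<omega>
      unfolding Y_def T_def by (simp add: left_diff_distrib sum_subtractf sum_distrib_left mult.assoc)
    have c1: "(CLINT \<omega>|M. iexp (Y \<omega> - \<alpha> * T \<omega>)) = exp (- (expectation (\<lambda>\<omega>. (Y \<omega>)\<^sup>2) - \<alpha>\<^sup>2 * \<tau>\<^sup>2) / 2)"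
      unfolding E[symmetric] comb by (rule char_combination)
    have c2: "(CLINT s|\<nu>. iexp (\<alpha> * s)) = exp (- (\<alpha>\<^sup>2 * \<tau>\<^sup>2) / 2)"
    proof -
      have D: "distributed \<nu> lborel (\<lambda>s. s) (normal_density 0 \<tau>)"
        unfolding distributed_def by (auto simp: \<nu>_def distr_id2)
      have "gaussian_rv \<nu> (\<lambda>s. \<alpha> * s)"
      \<comment> \<open>An affine image is normal only for nonzero slope; slope zero gives a
        constant, which counts as Gaussian.\<close>
      proof (cases "\<alpha> = 0")
        case False
        have "distributed \<nu> lborel (\<lambda>s. 0 + \<alpha> * s) (normal_density (0 + \<alpha> * 0) (\<bar>\<alpha>\<bar> * \<tau>))"
          by (rule \<nu>.normal_density_affine[OF D \<tau> False])
        then show ?thesis using \<tau> False unfolding gaussian_rv_def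
          by (intro conjI exI[of _ 0] exI[of _ "\<bar>\<alpha>\<bar> * \<tau>"] disjI1) auto
      qed (auto simp: gaussian_rv_def)
      moreover have "(\<integral>s. s \<partial>\<nu>) = 0" using \<nu>.normal_distributed_expectation[OF \<tau> D] .
      moreover have "(\<integral>s. s\<^sup>2 \<partial>\<nu>) = \<tau>\<^sup>2" using \<nu>.normal_distributed_variance[OF \<tau> D] \<open>(\<integral>s. s \<partial>\<nu>) = 0\<close> by simp
      ultimately show ?thesis
        using centered_gaussian_rv[OF \<nu>.prob_space_axioms, of "\<lambda>s. \<alpha> * s"] by (simp add: power_mult_distrib)
    qed
    have "(\<Sum>i\<in>I. c i * (X i \<omega> - a i * T \<omega> + a i * s)) = Y \<omega> - \<alpha> * T \<omega> + \<alpha> * s" for \<omega> s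
      unfolding Y_def \<alpha>_def
      by (simp add: algebra_simps sum.distrib sum_subtractf sum_distrib_left)
    then have "(CLINT p|M \<Otimes>\<^sub>M \<nu>. iexp (\<Sum>i\<in>I. c i * (X i (fst p) - a i * T (fst p) + a i * snd p)))
        = (CLINT p|M \<Otimes>\<^sub>M \<nu>. iexp (Y (fst p) - \<alpha> * T (fst p)) * iexp (\<alpha> * snd p))"
      by (simp add: exp_add distrib_left del: of_real_diff of_real_sum)
    also have "\<dots> = (CLINT \<omega>|M. (CLINT s|\<nu>. iexp (Y \<omega> - \<alpha> * T \<omega>) * iexp (\<alpha> * s)))"
      by (subst P.integral_fst'[symmetric])
         (auto intro!: P.integrable_const_bound[of _ 1] simp: norm_mult simp del: of_real_diff)
    also have "\<dots> = (CLINT \<omega>|M. iexp (Y \<omega> - \<alpha> * T \<omega>)) * (CLINT s|\<nu>. iexp (\<alpha> * s))"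
      by (simp del: of_real_diff)
    also have "\<dots> = exp (- expectation (\<lambda>\<omega>. (Y \<omega>)\<^sup>2) / 2)"
      unfolding c1 c2 by (simp add: of_real_mult[symmetric] exp_add[symmetric] diff_divide_distrib del: of_real_mult)
    also have "\<dots> = (CLINT \<omega>|M. iexp (Y \<omega>))"
      unfolding Y_def by (rule char_combination[symmetric])
    finally show "(CLINT \<omega>|M. iexp (\<Sum>i\<in>I. c i * X i \<omega>)) =
       (CLINT p|M \<Otimes>\<^sub>M \<nu>. iexp (\<Sum>i\<in>I. c i * (X i (fst p) - a i * T (fst p) + a i * snd p)))"
      by (simp only: Y_def)
  next
    fix i assume "i \<in> I"
    note [measurable] = measurable_component[OF this]
    show "(\<lambda>p. X i (fst p) - a i * T (fst p) + a i * snd p) \<in> borel_measurable (M \<Otimes>\<^sub>M \<nu>)"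
      by measurable
  qed auto
qed

end

section \<open>Symmetry of the Hessian\<close>

text \<open>\<open>deriv\<close> is informative only where a derivative exists. Differentiability of
  \<open>g\<close> and the chain rule provide it at every point of the line, as the mean value
  theorem requires.\<close>

lemma has_real_derivative_partial:
  assumes "g differentiable_on UNIV"
  shows "((\<lambda>t. g (y + t *\<^sub>R axis i 1)) has_real_derivative partial i g (y + s *\<^sub>R axis i 1)) (at s)"
proof -
  let ?k = "\<lambda>t. g (y + t *\<^sub>R axis i 1)"
  have "(\<lambda>t. y + t *\<^sub>R axis i 1) differentiable at s"
    by (intro differentiable_add differentiable_scaleR differentiable_ident differentiable_const)
  moreover have "g differentiable at (y + s *\<^sub>R axis i 1)"
    using assms by (simp add: differentiable_on_def)
  ultimately have "?k differentiable at s"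
    using differentiable_chain_at by (fastforce simp: o_def)
  then obtain D where D: "(?k has_real_derivative D) (at s)"
    unfolding real_differentiable_def by blast
  then have "((\<lambda>t. ?k (t + s)) has_real_derivative D) (at 0)"
    using DERIV_shift[of ?k D 0 s] by simp
  moreover have "(\<lambda>t. ?k (t + s)) = (\<lambda>t. g (y + s *\<^sub>R axis i 1 + t *\<^sub>R axis i 1))"
    by (simp add: algebra_simps)
  ultimately have "partial i g (y + s *\<^sub>R axis i 1) = D"
    unfolding partial_def by (simp add: DERIV_imp_deriv)
  with D show ?thesis by simp
qed

text \<open>The mean value theorem is applied in direction \<open>i\<close> to a difference of
  \<open>f\<close>, then in direction \<open>j\<close> to \<open>partial i f\<close>. The second
  difference is symmetric in \<open>i\<close> and \<open>j\<close>, the right-hand side is not; this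
  contrast forces the mixed partials to agree.\<close>

lemma second_difference_mean_value:
  assumes f: "f differentiable_on UNIV" and fi: "partial i f differentiable_on UNIV" and h: "h > 0"
  shows "\<exists>p. dist p x \<le> 2 * h \<and>
    f (x + h *\<^sub>R axis i 1 + h *\<^sub>R axis j 1) - f (x + h *\<^sub>R axis i 1) - f (x + h *\<^sub>R axis j 1) + f x
      = h\<^sup>2 * partial j (partial i f) p"
proof -
  let ?ei = "axis i 1 :: real^3" and ?ej = "axis j 1 :: real^3"
  define G where "G s = f (x + h *\<^sub>R ?ej + s *\<^sub>R ?ei) - f (x + s *\<^sub>R ?ei)" for s
  have "\<exists>\<xi>. 0 < \<xi> \<and> \<xi> < h \<and> G h - G 0 = (h - 0) * (partial i f (x + h *\<^sub>R ?ej + \<xi> *\<^sub>R ?ei) - partial i f (x + \<xi> *\<^sub>R ?ei))"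
    unfolding G_def
    by (intro MVT2 h DERIV_diff has_real_derivative_partial f)
  then obtain \<xi> where \<xi>: "0 < \<xi>" "\<xi> < h"
    and 1: "G h - G 0 = h * (partial i f (x + h *\<^sub>R ?ej + \<xi> *\<^sub>R ?ei) - partial i f (x + \<xi> *\<^sub>R ?ei))" by auto
  have "\<exists>\<eta>. 0 < \<eta> \<and> \<eta> < h \<and> partial i f (x + \<xi> *\<^sub>R ?ei + h *\<^sub>R ?ej) - partial i f (x + \<xi> *\<^sub>R ?ei + 0 *\<^sub>R ?ej)
      = (h - 0) * partial j (partial i f) (x + \<xi> *\<^sub>R ?ei + \<eta> *\<^sub>R ?ej)"
    by (intro MVT2 h has_real_derivative_partial fi)
  then obtain \<eta> where \<eta>: "0 < \<eta>" "\<eta> < h"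
    and 2: "partial i f (x + \<xi> *\<^sub>R ?ei + h *\<^sub>R ?ej) - partial i f (x + \<xi> *\<^sub>R ?ei)
      = h * partial j (partial i f) (x + \<xi> *\<^sub>R ?ei + \<eta> *\<^sub>R ?ej)" by auto
  show ?thesis
  proof (intro exI conjI)
    have "norm (\<xi> *\<^sub>R ?ei + \<eta> *\<^sub>R ?ej) \<le> norm (\<xi> *\<^sub>R ?ei) + norm (\<eta> *\<^sub>R ?ej)"
      by (rule norm_triangle_ineq)
    then show "dist (x + \<xi> *\<^sub>R ?ei + \<eta> *\<^sub>R ?ej) x \<le> 2 * h"
      using \<xi> \<eta> by (simp add: dist_norm add.assoc norm_axis_1)
    show "f (x + h *\<^sub>R ?ei + h *\<^sub>R ?ej) - f (x + h *\<^sub>R ?ei) - f (x + h *\<^sub>R ?ej) + f x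
      = h\<^sup>2 * partial j (partial i f) (x + \<xi> *\<^sub>R ?ei + \<eta> *\<^sub>R ?ej)"
      using 1 2 unfolding G_def by (simp add: power2_eq_square algebra_simps)
  qed
qed

lemma hessian_symmetric:
  assumes "twice_continuously_differentiable f"
  shows "hessian f x $ i $ j = hessian f x $ j $ i"
proof -
  have f: "f differentiable_on UNIV" "\<And>i. partial i f differentiable_on UNIV"
    and c: "\<And>i j. continuous_on UNIV (partial i (partial j f))"
    using assms by (auto simp: twice_continuously_differentiable_def)
  have "\<exists>p q. dist p x \<le> 2 * h \<and> dist q x \<le> 2 * h \<and>
      partial j (partial i f) p = partial i (partial j f) q" if h: "h > 0" for h
  proof -
    obtain p where p: "dist p x \<le> 2 * h"
        "f (x + h *\<^sub>R axis i 1 + h *\<^sub>R axis j 1) - f (x + h *\<^sub>R axis i 1) - f (x + h *\<^sub>R axis j 1) + f x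
          = h\<^sup>2 * partial j (partial i f) p"
      using second_difference_mean_value[OF f(1) f(2) h] by blast
    obtain q where q: "dist q x \<le> 2 * h"
        "f (x + h *\<^sub>R axis j 1 + h *\<^sub>R axis i 1) - f (x + h *\<^sub>R axis j 1) - f (x + h *\<^sub>R axis i 1) + f x
          = h\<^sup>2 * partial i (partial j f) q"
      using second_difference_mean_value[OF f(1) f(2) h] by blast
    have "x + h *\<^sub>R axis j 1 + h *\<^sub>R axis i 1 = x + h *\<^sub>R axis i 1 + h *\<^sub>R axis j 1" by simp
    then have "h\<^sup>2 * partial j (partial i f) p = h\<^sup>2 * partial i (partial j f) q"
      using p(2) q(2) by (simp only: p(2)[symmetric] q(2)[symmetric])
    then show ?thesis using h p(1) q(1) by auto
  qed
  \<comment> \<open>Steps of size \<open>1 / (n + 1)\<close> drive both intermediate points to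
    \<open>x\<close>, where continuity of the two mixed partials identifies the limits.\<close>
  then have "\<forall>n. \<exists>p q. dist p x \<le> 2 * inverse (real (Suc n)) \<and> dist q x \<le> 2 * inverse (real (Suc n)) \<and>
      partial j (partial i f) p = partial i (partial j f) q"
    by simp
  then obtain p q where pq: "\<And>n. dist (p n) x \<le> 2 * inverse (real (Suc n))"
      "\<And>n. dist (q n) x \<le> 2 * inverse (real (Suc n))"
      "\<And>n. partial j (partial i f) (p n) = partial i (partial j f) (q n)"
    by metis
  have lim: "(\<lambda>n. 2 * inverse (real (Suc n))) \<longlonglongrightarrow> 0"
    using tendsto_mult_right_zero[OF LIMSEQ_inverse_real_of_nat] by blast
  have "p \<longlonglongrightarrow> x"
    by (rule metric_tendsto_imp_tendsto[OF lim]) (use pq(1) in simp)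
  moreover have "q \<longlonglongrightarrow> x"
    by (rule metric_tendsto_imp_tendsto[OF lim]) (use pq(2) in simp)
  ultimately have "(\<lambda>n. partial j (partial i f) (p n)) \<longlonglongrightarrow> partial j (partial i f) x"
    "(\<lambda>n. partial i (partial j f) (q n)) \<longlonglongrightarrow> partial i (partial j f) x"
    using c by (auto intro: continuous_on_tendsto_compose[where s = UNIV])
  then have "partial j (partial i f) x = partial i (partial j f) x"
    unfolding pq(3) by (rule LIMSEQ_unique)
  then show ?thesis by (simp add: hessian_def)
qed

section \<open>Signs of the eigenvalues\<close>

text \<open>The sum of the principal 2 by 2 minors, i.e. the second elementary symmetric function of
  the eigenvalues (\<open>I_2\<close> in the Doroshkevich density). The ring is left general because
  real matrices are also viewed as complex ones.\<close>

definition minor_sum :: "'a::comm_ring_1^3^3 \<Rightarrow> 'a" where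
  "minor_sum A = A$1$1 * A$2$2 - A$1$2 * A$2$1 + A$1$1 * A$3$3 - A$1$3 * A$3$1 + A$2$2 * A$3$3 - A$2$3 * A$3$2"

lemma trace_3: "trace (A::'a::comm_ring_1^3^3) = A$1$1 + A$2$2 + A$3$3"
  by (simp add: trace_def sum_3)

lemma charpoly_3:
  fixes A :: "'a::comm_ring_1^3^3"
  shows "det (mat t - A) = t^3 - trace A * t^2 + minor_sum A * t - det A"
  by (simp add: det_3 trace_3 minor_sum_def mat_def) (simp add: algebra_simps power2_eq_square power3_eq_cube)

text \<open>For a complex eigenvector \<open>v\<close>, the Hermitian form \<open>S\<close> equals
  \<open>z\<close> times the positive squared norm \<open>n\<close>, while symmetry of the real
  matrix makes \<open>S\<close> its own conjugate.\<close>

lemma symmetric_matrix_complex_eigenvalue_real: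
  fixes A :: "real^3^3" and z :: complex
  assumes sym: "\<And>i j. A$i$j = A$j$i"
    and z: "z^3 - of_real (trace A) * z^2 + of_real (minor_sum A) * z - of_real (det A) = 0"
  shows "Im z = 0"
proof -
  define C :: "complex^3^3" where "C = (\<chi> i j. of_real (A$i$j))"
  have "trace C = of_real (trace A)" "minor_sum C = of_real (minor_sum A)" "det C = of_real (det A)"
    by (simp_all add: C_def trace_3 minor_sum_def det_3)
  then have "det (mat z - C) = 0"
    using z by (simp add: charpoly_3)
  then obtain v where v: "(mat z - C) *v v = 0" "v \<noteq> 0"
    using invertible_det_nz[of "mat z - C"] invertible_left_inverse[of "mat z - C"]
      matrix_left_invertible_ker[of "mat z - C"] by auto
  have eig: "(\<Sum>j\<in>UNIV. of_real (A$i$j) * v$j) = z * v$i" for i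
  proof -
    have "(\<Sum>j\<in>UNIV. (mat z - C)$i$j * v$j) = 0"
      using arg_cong[OF v(1), of "\<lambda>w. w$i"] by (simp add: matrix_vector_mult_def)
    then show ?thesis
      by (simp add: C_def mat_def left_diff_distrib sum_subtractf if_distrib[of "\<lambda>x. x * _"] cong: if_cong)
  qed
  define S where "S = (\<Sum>i\<in>UNIV. cnj (v$i) * (\<Sum>j\<in>UNIV. of_real (A$i$j) * v$j))"
  define n where "n = (\<Sum>i\<in>UNIV. (cmod (v$i))\<^sup>2)"
  have "S = (\<Sum>i\<in>UNIV. z * (v$i * cnj (v$i)))"
    unfolding S_def eig by (simp add: mult_ac)
  then have S: "S = z * of_real n"
    by (simp add: n_def sum_distrib_left complex_norm_square[symmetric])
  have "cnj S = (\<Sum>i\<in>UNIV. \<Sum>j\<in>UNIV. v$i * of_real (A$i$j) * cnj (v$j))"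
    by (simp add: S_def sum_distrib_left mult_ac)
  also have "\<dots> = (\<Sum>j\<in>UNIV. \<Sum>i\<in>UNIV. v$i * of_real (A$i$j) * cnj (v$j))"
    by (rule sum.swap)
  also have "\<dots> = S"
    unfolding S_def sum_distrib_left by (intro sum.cong refl) (subst sym, simp add: mult_ac)
  finally have "Im S = 0" by (simp add: complex_eq_iff)
  moreover have "n > 0"
  proof -
    obtain i where "v$i \<noteq> 0" using v(2) by (auto simp: vec_eq_iff)
    then show ?thesis unfolding n_def by (intro sum_pos2[of _ i]) auto
  qed
  ultimately show ?thesis using S by simp
qed

lemma real_cubic_root_exists:
  fixes a b c :: real
  shows "\<exists>r. r^3 - a * r^2 + b * r - c = 0"
proof -
  let ?p = "\<lambda>r. r^3 - a * r^2 + b * r - c"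
  \<comment> \<open>A Cauchy-type bound: the lower-order terms at \<open>K\<close> and
    \<open>-K\<close> are at most \<open>(K - 1) * K^2\<close>, so the cubic term determines the
    sign there.\<close>
  define K where "K = 1 + \<bar>a\<bar> + \<bar>b\<bar> + \<bar>c\<bar>"
  have K1: "K \<ge> 1" by (simp add: K_def)
  then have K2: "K^2 \<ge> K" "K^2 \<ge> 1" "K > 0"
    by (auto simp: power2_eq_square mult_le_cancel_left1 intro: order_trans)
  have "\<bar>a\<bar> * K^2 + \<bar>b\<bar> * K + \<bar>c\<bar> \<le> \<bar>a\<bar> * K^2 + \<bar>b\<bar> * K^2 + \<bar>c\<bar> * K^2"
    using K2 by (intro add_mono mult_left_mono) (auto simp: mult_le_cancel_left1)
  also have "\<dots> = (K - 1) * K^2" by (simp add: K_def algebra_simps)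
  also have "\<dots> < K^3" using K2 by (simp add: power2_eq_square power3_eq_cube algebra_simps)
  finally have bd: "\<bar>a * K^2\<bar> + \<bar>b * K\<bar> + \<bar>c\<bar> < K^3" using K2 by (simp add: abs_mult)
  have "?p (-K) \<le> 0" "0 \<le> ?p K" using bd by auto
  moreover have "continuous_on {-K..K} ?p" by (intro continuous_intros)
  ultimately show ?thesis using IVT'[of ?p "-K" 0 K] K2 by auto
qed

text \<open>Splitting off one real root leaves a real quadratic. A negative discriminant would give
  it a nonreal root, hence the symmetric matrix a nonreal eigenvalue.\<close>

lemma symmetric_matrix_charpoly_splits:
  fixes A :: "real^3^3"
  assumes sym: "\<And>i j. A$i$j = A$j$i"
  shows "\<exists>a b c. \<forall>t. det (t *\<^sub>R mat 1 - A) = (t - a) * (t - b) * (t - c)"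
proof -
  let ?p = "\<lambda>t. t^3 - trace A * t^2 + minor_sum A * t - det A"
  have det: "det (t *\<^sub>R mat 1 - A) = ?p t" for t
  proof -
    have "t *\<^sub>R mat 1 = (mat t :: real^3^3)" by (simp add: mat_def vec_eq_iff)
    then show ?thesis by (simp add: charpoly_3)
  qed
  obtain r where r: "?p r = 0" using real_cubic_root_exists by blast
  \<comment> \<open>\<open>b\<close> and \<open>c\<close> are the coefficients of the quotient on
    dividing the cubic by \<open>t - r\<close>.\<close>
  define b where "b = r - trace A"
  define c where "c = minor_sum A + r * b"
  have fac: "?p t = (t - r) * (t^2 + b * t + c)" for t
  proof -
    have "?p t = ?p t - ?p r" using r by simp
    also have "\<dots> = (t - r) * (t^2 + b * t + c)"
      by (simp add: b_def c_def algebra_simps power2_eq_square power3_eq_cube)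
    finally show ?thesis .
  qed
  have disc: "b\<^sup>2 - 4 * c \<ge> 0"
  proof (rule ccontr)
    assume "\<not> ?thesis"
    then have neg: "4 * c - b\<^sup>2 > 0" by simp
    define \<beta> where "\<beta> = sqrt (4 * c - b\<^sup>2) / 2"
    have \<beta>2: "\<beta>\<^sup>2 = c - b\<^sup>2 / 4" and \<beta>0: "\<beta> > 0" using neg by (simp_all add: \<beta>_def power_divide)
    define z where "z = Complex (- b / 2) \<beta>"
    have quad: "z^2 + of_real b * z + of_real c = 0"
      using \<beta>2 by (simp add: z_def complex_eq_iff power2_eq_square field_simps)
    have det_r: "det A = r^3 - trace A * r^2 + minor_sum A * r" using r by simp
    have "z^3 - of_real (trace A) * z^2 + of_real (minor_sum A) * z - of_real (det A)
       = (z - of_real r) * (z^2 + of_real b * z + of_real c)"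
      unfolding det_r b_def c_def by (simp add: algebra_simps power2_eq_square power3_eq_cube)
    then have "Im z = 0"
      using symmetric_matrix_complex_eigenvalue_real[OF sym] quad by simp
    with \<beta>0 show False by (simp add: z_def)
  qed
  define s where "s = sqrt (b\<^sup>2 - 4 * c)"
  have s2: "s * s = b\<^sup>2 - 4 * c" using disc by (simp add: s_def)
  have "t^2 + b * t + c = (t - (- b + s) / 2) * (t - (- b - s) / 2)" for t
    using s2 by (simp add: field_simps power2_eq_square)
  then have "\<forall>t. det (t *\<^sub>R mat 1 - A) = (t - r) * (t - (- b + s) / 2) * (t - (- b - s) / 2)"
    using det fac by (simp add: mult.assoc)
  then show ?thesis by blast
qed

section \<open>Ordered roots and their reflection\<close>

lemma sorted_roots_unique:
  fixes a b c a' b' c' :: real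
  assumes eq: "\<And>t. (t - a) * (t - b) * (t - c) = (t - a') * (t - b') * (t - c')"
    and o: "a \<ge> b" "b \<ge> c" "a' \<ge> b'" "b' \<ge> c'"
  shows "a = a' \<and> b = b' \<and> c = c'"
proof -
  have "a = a'" using eq[of a] eq[of a'] o by auto
  moreover have "c = c'" using eq[of c] eq[of c'] o by auto
  \<comment> \<open>The extreme roots agree because each is a root of the other product; the middle
    one follows from the coefficient of \<open>t^2\<close>, which the values at 0, 1 and -1
    determine.\<close>
  moreover have "a + b + c = a' + b' + c'"
    using eq[of 0] eq[of 1] eq[of "-1"] by (simp add: algebra_simps)
  ultimately show ?thesis by simp
qed

lemma sort3_exists:
  fixes a b c :: real
  shows "\<exists>x y z. x \<ge> y \<and> y \<ge> z \<and> (\<forall>t. (t - a) * (t - b) * (t - c) = (t - x) * (t - y) * (t - z))"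
proof -
  have *: ?thesis if "x \<ge> y" "y \<ge> z"
    "\<And>t. (t - a) * (t - b) * (t - c) = (t - x) * (t - y) * (t - z)" for x y z
    using that by blast
  consider "a \<ge> b" "b \<ge> c" | "a \<ge> c" "c \<ge> b" | "b \<ge> a" "a \<ge> c" | "b \<ge> c" "c \<ge> a" | "c \<ge> a" "a \<ge> b" | "c \<ge> b" "b \<ge> a"
    by linarith
  then show ?thesis
    by cases (erule (1) *, simp add: mult_ac)+
qed

lemma ordered_eigenvalues_eqI:
  assumes "a \<ge> b" "b \<ge> c" and "\<And>t. det (t *\<^sub>R mat 1 - A) = (t - a) * (t - b) * (t - c)"
  shows "ordered_eigenvalues A = vector [a, b, c]"
  unfolding ordered_eigenvalues_def
proof (rule the_equality)
  show "(vector [a, b, c] :: real^3) $ 1 \<ge> (vector [a, b, c] :: real^3) $ 2 \<and> (vector [a, b, c] :: real^3) $ 2 \<ge> (vector [a, b, c] :: real^3) $ 3 \<and>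
     (\<forall>t. det (t *\<^sub>R mat 1 - A) = (t - (vector [a, b, c] :: real^3) $ 1) * (t - (vector [a, b, c] :: real^3) $ 2) * (t - (vector [a, b, c] :: real^3) $ 3))"
    using assms by simp
  fix l :: "real^3"
  assume l: "l $ 1 \<ge> l $ 2 \<and> l $ 2 \<ge> l $ 3 \<and>
     (\<forall>t. det (t *\<^sub>R mat 1 - A) = (t - l $ 1) * (t - l $ 2) * (t - l $ 3))"
  then have "l $ 1 = a \<and> l $ 2 = b \<and> l $ 3 = c"
    using assms by (intro sorted_roots_unique) auto
  then show "l = vector [a, b, c]" by (simp add: vec_eq_iff forall_3)
qed

lemma ordered_eigenvalues_symmetric:
  assumes sym: "\<And>i j. A$i$j = A$j$i"
  obtains a b c where "a \<ge> b" "b \<ge> c" "ordered_eigenvalues A = vector [a, b, c]"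
    "ordered_eigenvalues (- A) = vector [- c, - b, - a]"
    "trace A = a + b + c" "minor_sum A = a * b + a * c + b * c" "det A = a * b * c"
proof -
  obtain a b c where abc: "a \<ge> b" "b \<ge> c" and p: "\<And>t. det (t *\<^sub>R mat 1 - A) = (t - a) * (t - b) * (t - c)"
    using symmetric_matrix_charpoly_splits[OF sym] sort3_exists by metis
  have mat: "t *\<^sub>R mat 1 = (mat t :: real^3^3)" for t by (simp add: mat_def vec_eq_iff)
  \<comment> \<open>The dimension is odd, so negating the matrix changes the sign of the
    determinant; the roots change sign and their order reverses.\<close>
  have neg: "det (t *\<^sub>R mat 1 - (- A)) = (t - - c) * (t - - b) * (t - - a)" for t
  proof -
    have "det (t *\<^sub>R mat 1 - (- A)) = - det ((- t) *\<^sub>R mat 1 - A)"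
      unfolding mat det_3 by (simp add: mat_def) (simp add: algebra_simps)
    then show ?thesis unfolding p by (simp add: algebra_simps)
  qed
  have coef: "t^3 - trace A * t^2 + minor_sum A * t - det A = (t - a) * (t - b) * (t - c)" for t
    using p[of t] by (simp add: mat charpoly_3)
  have "trace A = a + b + c" "minor_sum A = a * b + a * c + b * c" "det A = a * b * c"
    using coef[of 0] coef[of 1] coef[of "-1"] by (simp_all add: algebra_simps)
  then show thesis
    using that[OF abc ordered_eigenvalues_eqI[OF abc p] ordered_eigenvalues_eqI[OF _ _ neg]] abc by simp
qed

section \<open>Counting positive eigenvalues\<close>

definition num_positive_eigenvalues :: "real^3^3 \<Rightarrow> nat" where
  "num_positive_eigenvalues A = card {i. ordered_eigenvalues A $ i > 0}"

lemma card_positive_vector: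
  "card {i. (vector [a, b, c] :: real^3) $ i > 0} = of_bool (a > 0) + of_bool (b > 0) + of_bool (c > 0)"
proof -
  have "card {i. (vector [a, b, c] :: real^3) $ i > 0} = (\<Sum>i\<in>UNIV. of_bool ((vector [a, b, c] :: real^3) $ i > 0))"
    by (simp add: sum.If_cases of_bool_def)
  then show ?thesis by (simp add: sum_3)
qed

text \<open>A zero eigenvalue would be counted neither for \<open>A\<close> nor for
  \<open>- A\<close>; a nonzero determinant excludes it.\<close>

lemma num_positive_eigenvalues_uminus:
  assumes sym: "\<And>i j. A$i$j = A$j$i" and "det A \<noteq> 0"
  shows "num_positive_eigenvalues (- A) + num_positive_eigenvalues A = 3"
proof -
  obtain a b c where "a \<ge> b" "b \<ge> c" "ordered_eigenvalues A = vector [a, b, c]"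
      "ordered_eigenvalues (- A) = vector [- c, - b, - a]" "det A = a * b * c"
    using ordered_eigenvalues_symmetric[OF sym] by metis
  then show ?thesis
    using \<open>det A \<noteq> 0\<close> by (auto simp: num_positive_eigenvalues_def card_positive_vector)
qed

text \<open>Expresses the number of positive roots of a real-rooted cubic by the signs of its
  coefficients; unlike the eigenvalues, these are visibly measurable in the entries.\<close>

definition eigenvalue_signature :: "nat \<Rightarrow> real^3^3 \<Rightarrow> bool" where
  "eigenvalue_signature k A \<longleftrightarrow>
    (let C = trace A > 0 \<and> minor_sum A > 0 \<and> det A > 0;
         V = trace A \<le> 0 \<and> minor_sum A \<ge> 0 \<and> det A \<le> 0;
         W = (det A > 0 \<and> \<not> C) \<or> (det A = 0 \<and> (minor_sum A < 0 \<or> (minor_sum A = 0 \<and> trace A > 0)))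
     in k = (if C then 3 else if V then 0 else if W then 1 else 2))"

text \<open>If all \<open>e\<close>s are positive, the cubic is negative on
  \<open>t \<le> 0\<close>, so its least root is positive. With \<open>e1 \<le> 0\<close>,
  \<open>e2 \<ge> 0\<close>, \<open>e3 \<le> 0\<close> it is positive on \<open>t > 0\<close>, so
  its greatest root is not.\<close>

lemma positive_count_by_symmetric_functions:
  fixes a b c :: real
  assumes "a \<ge> b" "b \<ge> c"
  defines "e1 \<equiv> a + b + c" and "e2 \<equiv> a * b + a * c + b * c" and "e3 \<equiv> a * b * c"
  shows "c > 0 \<longleftrightarrow> e1 > 0 \<and> e2 > 0 \<and> e3 > 0"
    and "a \<le> 0 \<longleftrightarrow> e1 \<le> 0 \<and> e2 \<ge> 0 \<and> e3 \<le> 0"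
    and "a > 0 \<Longrightarrow> c \<le> 0 \<Longrightarrow> b \<le> 0 \<longleftrightarrow> e3 > 0 \<or> (e3 = 0 \<and> (e2 < 0 \<or> (e2 = 0 \<and> e1 > 0)))"
proof -
  have p: "t^3 - e1 * t^2 + e2 * t - e3 = (t - a) * (t - b) * (t - c)" for t
    by (simp add: e1_def e2_def e3_def algebra_simps power2_eq_square power3_eq_cube)
  show "c > 0 \<longleftrightarrow> e1 > 0 \<and> e2 > 0 \<and> e3 > 0"
  proof
    assume "c > 0"
    then have "c > 0" "b > 0" "a > 0" using assms by auto
    then show "e1 > 0 \<and> e2 > 0 \<and> e3 > 0" by (simp add: e1_def e2_def e3_def add_pos_pos)
  next
    assume e: "e1 > 0 \<and> e2 > 0 \<and> e3 > 0"
    show "c > 0"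
    proof (rule ccontr)
      assume "\<not> c > 0"
      then have c: "c \<le> 0" by simp
      then have "c^3 \<le> 0" "e1 * c^2 \<ge> 0" "e2 * c \<le> 0"
        using e by (auto simp: power3_eq_cube mult_nonpos_nonneg mult_nonneg_nonpos zero_le_mult_iff mult_le_0_iff)
      moreover have "c^3 - e1 * c^2 + e2 * c - e3 = 0" using p[of c] by simp
      ultimately show False using e by linarith
    qed
  qed
  show "a \<le> 0 \<longleftrightarrow> e1 \<le> 0 \<and> e2 \<ge> 0 \<and> e3 \<le> 0"
  proof
    assume "a \<le> 0"
    then have "c \<le> 0" "b \<le> 0" "a \<le> 0" using assms by auto
    then show "e1 \<le> 0 \<and> e2 \<ge> 0 \<and> e3 \<le> 0"
      by (auto simp: e1_def e2_def e3_def mult_nonpos_nonpos mult_nonneg_nonpos)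
  next
    assume e: "e1 \<le> 0 \<and> e2 \<ge> 0 \<and> e3 \<le> 0"
    show "a \<le> 0"
    proof (rule ccontr)
      assume "\<not> a \<le> 0"
      then have c: "a > 0" by simp
      then have "a^3 > 0" "e1 * a^2 \<le> 0" "e2 * a \<ge> 0"
        using e by (auto simp: mult_nonpos_nonneg)
      moreover have "a^3 - e1 * a^2 + e2 * a - e3 = 0" using p[of a] by simp
      ultimately show False using e by linarith
    qed
  qed
  show "b \<le> 0 \<longleftrightarrow> e3 > 0 \<or> (e3 = 0 \<and> (e2 < 0 \<or> (e2 = 0 \<and> e1 > 0)))" if a: "a > 0" and c: "c \<le> 0"
  proof -
    \<comment> \<open>Only zero roots make \<open>e3\<close> vanish: with one of them
      \<open>e2\<close> is the product of the other two roots, with two of them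
      \<open>e2 = 0\<close> and \<open>e1 = a\<close>.\<close>
    consider "b > 0" "c < 0" | "b > 0" "c = 0" | "b = 0" "c < 0" | "b = 0" "c = 0" | "b < 0" "c < 0"
      using assms c by linarith
    then show ?thesis
    proof cases
      case 1 then have "e3 < 0" using a by (simp add: e3_def mult_pos_neg)
      then show ?thesis using 1 by simp
    next
      case 2 then show ?thesis using a by (simp add: e3_def e2_def mult_pos_pos not_less less_imp_le)
    next
      case 3 then show ?thesis using a by (simp add: e3_def e2_def mult_pos_neg)
    next
      case 4 then show ?thesis using a by (simp add: e3_def e2_def e1_def)
    next
      case 5 then have "e3 > 0" using a unfolding e3_def by (simp add: mult_neg_neg mult_pos_neg)
      then show ?thesis using 5 by simp
    qed
  qed
qed

text \<open>The equivalence includes singular matrices, so it yields measurability of the counting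
  events without discarding a null set.\<close>

lemma num_positive_eigenvalues_eq_iff:
  assumes sym: "\<And>i j. A$i$j = A$j$i"
  shows "num_positive_eigenvalues A = k \<longleftrightarrow> eigenvalue_signature k A"
proof -
  obtain a b c where abc: "a \<ge> b" "b \<ge> c" and l: "ordered_eigenvalues A = vector [a, b, c]"
    and e: "trace A = a + b + c" "minor_sum A = a * b + a * c + b * c" "det A = a * b * c"
    using ordered_eigenvalues_symmetric[OF sym] by metis
  note pc = positive_count_by_symmetric_functions[OF abc, folded e]
  show ?thesis
    unfolding num_positive_eigenvalues_def l card_positive_vector eigenvalue_signature_def Let_def
      pc(1)[symmetric] pc(2)[symmetric]
    using pc(3) abc by (cases "c > 0"; cases "a \<le> 0") auto
qed

section \<open>Reflection of the tidal tensor\<close>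

definition matrix_of_family :: "(3 \<times> 3 \<Rightarrow> real) \<Rightarrow> real^3^3" where
  "matrix_of_family f = (\<chi> i j. f (i, j))"

lemma measurable_matrix_invariants [measurable]:
  "(\<lambda>f. det (matrix_of_family f)) \<in> borel_measurable (\<Pi>\<^sub>M p\<in>UNIV. borel)"
  "(\<lambda>f. trace (matrix_of_family f)) \<in> borel_measurable (\<Pi>\<^sub>M p\<in>UNIV. borel)"
  "(\<lambda>f. minor_sum (matrix_of_family f)) \<in> borel_measurable (\<Pi>\<^sub>M p\<in>UNIV. borel)"
  unfolding det_3 trace_3 minor_sum_def matrix_of_family_def vec_lambda_beta by measurable

lemma measurable_eigenvalue_signature [measurable]:
  "Measurable.pred (\<Pi>\<^sub>M p\<in>UNIV. borel) (\<lambda>f. eigenvalue_signature k (matrix_of_family f))"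
  unfolding eigenvalue_signature_def Let_def by measurable

section \<open>Almost sure invertibility and the reflection\<close>

lemma sum_UNIV_3x3: "(\<Sum>p\<in>(UNIV :: (3 \<times> 3) set). g p) = (\<Sum>i\<in>UNIV. \<Sum>j\<in>UNIV. g (i, j))"
  by (simp add: sum.cartesian_product UNIV_Times_UNIV[symmetric] del: UNIV_Times_UNIV)

text \<open>The matrix \<open>mat (s / 3)\<close> is the multiple of the identity with trace
  \<open>s\<close>. The leading coefficient \<open>1 / 27\<close> keeps the cubic in
  \<open>s\<close> from vanishing identically, whatever \<open>B\<close> is.\<close>

lemma finite_det_shift_zeros:
  fixes B :: "real^3^3"
  shows "finite {s. det (B + mat (s / 3)) = 0}"
proof -
  let ?q = "[:det B, minor_sum B / 3, trace B / 9, 1 / 27:]"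
  have "det (B + mat (s / 3)) = poly ?q s" for s
    by (simp add: det_3 trace_3 minor_sum_def mat_def) (simp add: field_simps)
  moreover have "finite {s. poly ?q s = 0}" by (intro poly_roots_finite) simp
  ultimately show ?thesis by simp
qed

lemma det_nonzero_AE:
  assumes M: "prob_space M" and \<sigma>: "\<sigma>\<^sup>2 > 0" and law: "isotropic_tidal_law M \<sigma> \<Psi>"
  shows "AE \<omega> in M. det (\<Psi> \<omega>) \<noteq> 0"
proof -
  define X where "X = (\<lambda>(i, j) \<omega>. \<Psi> \<omega> $ i $ j)"
  interpret centered_gaussian_family M UNIV X
    using M law unfolding isotropic_tidal_law_def X_def
    by (intro centered_gaussian_family.intro centered_gaussian_family_axioms.intro) auto
  \<comment> \<open>With Kronecker coefficients, \<open>T\<close> is the trace.\<close>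
  define d :: "3 \<times> 3 \<Rightarrow> real" where "d = (\<lambda>(i, j). kronecker i j)"
  define T where "T = (\<lambda>\<omega>. \<Sum>p\<in>UNIV. d p * X p \<omega>)"
  define \<tau> where "\<tau> = \<bar>\<sigma>\<bar>"
  have \<tau>: "\<tau> > 0" "\<tau>\<^sup>2 = \<sigma>\<^sup>2" using \<sigma> by (auto simp: \<tau>_def)
  have [measurable]: "X p \<in> borel_measurable M" for p by simp
  have X2: "integrable M (\<lambda>\<omega>. (X p \<omega>)\<^sup>2)" for p
    using gaussian_rv_integrable(2)[OF M gaussian_rv_component] by simp
  have XX: "integrable M (\<lambda>\<omega>. X p \<omega> * X q \<omega>)" for p q
    by (rule integrable_mult_of_squares) (use X2 in auto)
  have EXX: "expectation (\<lambda>\<omega>. X (i, j) \<omega> * X (k, l) \<omega>) = \<sigma>\<^sup>2 / 15 * (kronecker i j * kronecker k l + kronecker i k * kronecker j l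
                   + kronecker i l * kronecker j k)" for i j k l
    using law unfolding isotropic_tidal_law_def X_def by simp
  \<comment> \<open>Contracting the covariance with the identity gives
    \<open>\<sigma>\<^sup>2 / 15 * (3 + 2)\<close> on the diagonal and zero off it, so the
    regression coefficient on the trace is \<open>d p / 3\<close>. Summing over the diagonal then
    gives the trace the variance \<open>\<sigma>\<^sup>2\<close>.\<close>
  have cov: "expectation (\<lambda>\<omega>. T \<omega> * X p \<omega>) = (d p / 3) * \<tau>\<^sup>2" for p
  proof -
    obtain i j where p: "p = (i, j)" by fastforce
    have "expectation (\<lambda>\<omega>. T \<omega> * X p \<omega>) = expectation (\<lambda>\<omega>. \<Sum>q\<in>UNIV. d q * (X q \<omega> * X p \<omega>))"
      by (simp add: T_def sum_distrib_right mult.assoc)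
    also have "\<dots> = (\<Sum>q\<in>UNIV. d q * expectation (\<lambda>\<omega>. X q \<omega> * X p \<omega>))"
      using XX by (subst Bochner_Integration.integral_sum) auto
    also have "\<dots> = \<sigma>\<^sup>2 / 3 * kronecker i j"
      unfolding sum_UNIV_3x3 p EXX d_def using exhaust_3[of i] exhaust_3[of j]
      by (auto simp: sum_3 kronecker_def)
    finally show ?thesis using \<tau> by (simp add: p d_def)
  qed
  have TX: "integrable M (\<lambda>\<omega>. T \<omega> * X p \<omega>)" for p
  proof -
    have "integrable M (\<lambda>\<omega>. \<Sum>q\<in>UNIV. d q * (X q \<omega> * X p \<omega>))" using XX by auto
    then show ?thesis by (simp add: T_def sum_distrib_right mult.assoc)
  qed
  have var: "expectation (\<lambda>\<omega>. (T \<omega>)\<^sup>2) = \<tau>\<^sup>2"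
  proof -
    have "(T \<omega>)\<^sup>2 = (\<Sum>p\<in>UNIV. d p * (T \<omega> * X p \<omega>))" for \<omega>
    proof -
      have "(T \<omega>)\<^sup>2 = T \<omega> * (\<Sum>p\<in>UNIV. d p * X p \<omega>)" by (simp add: T_def power2_eq_square)
      then show ?thesis by (simp add: sum_distrib_left mult_ac)
    qed
    then have "expectation (\<lambda>\<omega>. (T \<omega>)\<^sup>2) = (\<Sum>p\<in>UNIV. d p * expectation (\<lambda>\<omega>. T \<omega> * X p \<omega>))"
      using TX by simp
    also have "\<dots> = (\<Sum>p\<in>UNIV. d p * (d p / 3 * \<tau>\<^sup>2))"
      by (simp only: cov)
    also have "\<dots> = \<tau>\<^sup>2"
      unfolding sum_UNIV_3x3 d_def by (simp add: sum_3 kronecker_def)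
    finally show ?thesis .
  qed
  define \<nu> where "\<nu> = density lborel (normal_density 0 \<tau>)"
  interpret \<nu>: prob_space \<nu> unfolding \<nu>_def by (rule prob_space_normal_density[OF \<tau>(1)])
  have s\<nu> [measurable_cong]: "sets \<nu> = sets borel" by (simp add: \<nu>_def)
  interpret P: pair_prob_space M \<nu> ..
  let ?Y = "\<lambda>p q. X q (fst p) - d q / 3 * T (fst p) + d q / 3 * snd p"
  have T [measurable]: "T \<in> borel_measurable M" unfolding T_def by measurable
  have Ym: "(\<lambda>p. \<lambda>q\<in>UNIV. ?Y p q) \<in> measurable (M \<Otimes>\<^sub>M \<nu>) (\<Pi>\<^sub>M q\<in>UNIV. borel)"
    by (intro measurable_restrict) measurable
  have Xm: "(\<lambda>\<omega>. \<lambda>q\<in>UNIV. X q \<omega>) \<in> measurable M (\<Pi>\<^sub>M q\<in>UNIV. borel)"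
    by (intro measurable_restrict) measurable
  have eq: "distr M (\<Pi>\<^sub>M q\<in>UNIV. borel) (\<lambda>\<omega>. \<lambda>q\<in>UNIV. X q \<omega>) =
      distr (M \<Otimes>\<^sub>M \<nu>) (\<Pi>\<^sub>M q\<in>UNIV. borel) (\<lambda>p. \<lambda>q\<in>UNIV. ?Y p q)"
    unfolding \<nu>_def T_def
    by (rule law_resample[where a = "\<lambda>q. d q / 3"]) (use \<tau>(1) var cov in \<open>simp_all add: T_def\<close>)
  have "AE p in M \<Otimes>\<^sub>M \<nu>. det (matrix_of_family (\<lambda>q\<in>UNIV. ?Y p q)) \<noteq> 0"
  proof (rule P.AE_pair_measure)
    show "{p \<in> space (M \<Otimes>\<^sub>M \<nu>). det (matrix_of_family (\<lambda>q\<in>UNIV. ?Y p q)) \<noteq> 0} \<in> sets (M \<Otimes>\<^sub>M \<nu>)"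
      using Ym by measurable
    show "AE \<omega> in M. AE s in \<nu>. det (matrix_of_family (\<lambda>q\<in>UNIV. ?Y (\<omega>, s) q)) \<noteq> 0"
    proof (rule AE_I2)
      fix \<omega>
      \<comment> \<open>The traceless part, fixed together with \<open>\<omega>\<close>. The
        finitely many bad values of \<open>s\<close> form a Lebesgue null set, hence a null set for
        the Gaussian density.\<close>
      let ?B = "\<chi> i j. X (i, j) \<omega> - d (i, j) / 3 * T \<omega>"
      have B: "matrix_of_family (\<lambda>q\<in>UNIV. ?Y (\<omega>, s) q) = ?B + mat (s / 3)" for s
        by (simp add: matrix_of_family_def vec_eq_iff mat_def d_def kronecker_def)
      have "AE s in lborel. s \<notin> {s. det (?B + mat (s / 3)) = 0}"
        by (rule AE_not_in[OF finite_imp_null_set_lborel[OF finite_det_shift_zeros]])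
      then show "AE s in \<nu>. det (matrix_of_family (\<lambda>q\<in>UNIV. ?Y (\<omega>, s) q)) \<noteq> 0"
        unfolding \<nu>_def B by (subst AE_density) auto
    qed
  qed
  then have "AE f in distr M (\<Pi>\<^sub>M q\<in>UNIV. borel) (\<lambda>\<omega>. \<lambda>q\<in>UNIV. X q \<omega>). det (matrix_of_family f) \<noteq> 0"
    unfolding eq by (subst AE_distr_iff[OF Ym]) auto
  then have "AE \<omega> in M. det (matrix_of_family (\<lambda>q\<in>UNIV. X q \<omega>)) \<noteq> 0"
    by (subst (asm) AE_distr_iff[OF Xm]) auto
  moreover have "matrix_of_family (\<lambda>q\<in>UNIV. X q \<omega>) = \<Psi> \<omega>" for \<omega>
    by (simp add: matrix_of_family_def X_def vec_eq_iff)
  ultimately show ?thesis by simp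
qed

lemma volume_fraction_reflect:
  assumes M: "prob_space M" and \<sigma>: "\<sigma>\<^sup>2 > 0" and law: "isotropic_tidal_law M \<sigma> \<Psi>"
    and sym: "\<And>\<omega> i j. \<omega> \<in> space M \<Longrightarrow> \<Psi> \<omega> $ i $ j = \<Psi> \<omega> $ j $ i"
    and ab: "num_eigenvalues_above a + num_eigenvalues_above b = 3"
  shows "volume_fraction M \<Psi> 0 a = volume_fraction M \<Psi> 0 b"
proof -
  define X where "X = (\<lambda>(i, j) \<omega>. \<Psi> \<omega> $ i $ j)"
  interpret centered_gaussian_family M UNIV X
    using M law unfolding isotropic_tidal_law_def X_def
    by (intro centered_gaussian_family.intro centered_gaussian_family_axioms.intro) auto
  have [measurable]: "X p \<in> borel_measurable M" for p by simp
  have Xm: "(\<lambda>\<omega>. \<lambda>q\<in>UNIV. X q \<omega>) \<in> measurable M (\<Pi>\<^sub>M q\<in>UNIV. borel)"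
    "(\<lambda>\<omega>. \<lambda>q\<in>UNIV. - X q \<omega>) \<in> measurable M (\<Pi>\<^sub>M q\<in>UNIV. borel)"
    by (intro measurable_restrict; measurable)+
  have mX: "matrix_of_family (\<lambda>q\<in>UNIV. X q \<omega>) = \<Psi> \<omega>" "matrix_of_family (\<lambda>q\<in>UNIV. - X q \<omega>) = - \<Psi> \<omega>" for \<omega>
    by (simp_all add: matrix_of_family_def X_def vec_eq_iff)
  \<comment> \<open>The laws live on families of nine arbitrary entries, including nonsymmetric
    matrices, for which \<open>ordered_eigenvalues\<close> need not be meaningful. The signature is
    total and measurable there, and agrees with the count on the symmetric realizations.\<close>
  have sig: "{\<omega> \<in> space M. num_positive_eigenvalues (\<Psi> \<omega>) = k} = {\<omega> \<in> space M. eigenvalue_signature k (\<Psi> \<omega>)}"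
    "{\<omega> \<in> space M. num_positive_eigenvalues (- \<Psi> \<omega>) = k} = {\<omega> \<in> space M. eigenvalue_signature k (- \<Psi> \<omega>)}" for k
    using sym by (simp_all add: num_positive_eigenvalues_eq_iff cong: conj_cong)
  have meas: "{\<omega> \<in> space M. eigenvalue_signature k (\<Psi> \<omega>)} \<in> sets M"
    "{\<omega> \<in> space M. eigenvalue_signature k (- \<Psi> \<omega>)} \<in> sets M" for k
    subgoal unfolding mX(1)[symmetric] using Xm(1) by measurable
    subgoal unfolding mX(2)[symmetric] using Xm(2) by measurable
    done
  have D: "measure (distr M (\<Pi>\<^sub>M q\<in>UNIV. borel) Z) {f \<in> space (\<Pi>\<^sub>M q\<in>UNIV. borel). eigenvalue_signature k (matrix_of_family f)}
      = prob {\<omega> \<in> space M. eigenvalue_signature k (matrix_of_family (Z \<omega>))}"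
    if Z: "Z \<in> measurable M (\<Pi>\<^sub>M q\<in>UNIV. borel)" for Z k
    by (subst measure_distr[OF Z])
       (use measurable_space[OF Z] in \<open>auto intro!: arg_cong[where f = prob]\<close>)
  have "prob {\<omega> \<in> space M. num_positive_eigenvalues (\<Psi> \<omega>) = k} = prob {\<omega> \<in> space M. num_positive_eigenvalues (- \<Psi> \<omega>) = k}" for k
    using D[OF Xm(1), of k] D[OF Xm(2), of k] unfolding law_symmetric sig mX by simp
  moreover have "prob {\<omega> \<in> space M. num_positive_eigenvalues (- \<Psi> \<omega>) = num_eigenvalues_above a}
      = prob {\<omega> \<in> space M. num_positive_eigenvalues (\<Psi> \<omega>) = num_eigenvalues_above b}"
  proof (rule finite_measure_eq_AE)
    show "AE \<omega> in M. \<omega> \<in> {\<omega> \<in> space M. num_positive_eigenvalues (- \<Psi> \<omega>) = num_eigenvalues_above a}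
        \<longleftrightarrow> \<omega> \<in> {\<omega> \<in> space M. num_positive_eigenvalues (\<Psi> \<omega>) = num_eigenvalues_above b}"
      using det_nonzero_AE[OF M \<sigma> law] AE_space
    proof eventually_elim
      case (elim \<omega>)
      then show ?case
        using num_positive_eigenvalues_uminus[OF sym[OF elim(2)] elim(1)] ab by auto
    qed
  qed (simp_all only: sig meas)
  ultimately show ?thesis
    by (simp add: volume_fraction_def num_positive_eigenvalues_def)
qed

theorem mainTheorem1:
  fixes M :: "'w measure"
    and \<delta> \<phi> :: "real^3 \<Rightarrow> 'w \<Rightarrow> real"
    and \<sigma> :: real
    and x :: "real^3"
  assumes "prob_space M"
    and "gaussian_field M \<delta>"
    and "zero_mean_field M \<delta>"
    and "homogeneous_field M \<delta>"
    and "isotropic_field M \<delta>"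
    and "\<And>y. prob_space.variance M (\<delta> y) = \<sigma>\<^sup>2"
    and "\<sigma>\<^sup>2 > 0"
    and "potential_of M \<delta> \<phi>"
    and "isotropic_tidal_law M \<sigma> (tidal_tensor \<phi> x)"
  shows "volume_fraction M (tidal_tensor \<phi> x) 0 Cluster =
           volume_fraction M (tidal_tensor \<phi> x) 0 Void \<and>
         volume_fraction M (tidal_tensor \<phi> x) 0 Filament =
           volume_fraction M (tidal_tensor \<phi> x) 0 Wall"
proof -
  \<comment> \<open>Smoothness gives symmetry for every realization; the covariance alone would give
    it only almost surely.\<close>
  have sym: "tidal_tensor \<phi> x \<omega> $ i $ j = tidal_tensor \<phi> x \<omega> $ j $ i" if "\<omega> \<in> space M" for \<omega> i j
    using \<open>potential_of M \<delta> \<phi>\<close> that hessian_symmetric unfolding potential_of_def tidal_tensor_def by blast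
  show ?thesis
    using volume_fraction_reflect[OF \<open>prob_space M\<close> \<open>\<sigma>\<^sup>2 > 0\<close> \<open>isotropic_tidal_law M \<sigma> (tidal_tensor \<phi> x)\<close> sym] by simp
qed

end
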